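(* Let $K\subset\mathbb{R}^2$ be a closed (compact), strictly convex domain enclosed by a smooth closed curve $\gamma$ with positive curvature $\kappa>0$, and let $S(K)$ be its Steiner disk. For real parameters $(\alpha,\delta,\mu,\sigma,\eta,\lambda,\xi,\zeta)$ put $$W:=\alpha\int_0^{2\pi}\rho(\theta)^2\,d\theta+\delta L^2+\mu A+\sigma|\tilde A|+\eta\int_0^{2\pi}\rho_\beta(\theta)^2\,d\theta+\lambda(\rho_e-\rho_i)^2+\xi(\rho_M-\rho_m)^2+\zeta\oint_\gamma\kappa^2\,ds ,$$ $$E:=6\pi\alpha-\pi\mu+4\pi\sigma+24\pi\eta+4\lambda+4\xi-12\pi\zeta,\qquad C:=\frac{2\pi}{3E}.$$ Consider the conditions $$( * )\qquad \eta,\xi,\zeta\ge 0,\quad \lambda\le 0,\quad 2\alpha+4\pi\delta+\mu-4\zeta\ge 0,\quad 2\alpha+\sigma-2\eta-4\zeta\ge 0,\quad E>0.$$ (i) If the parameters satisfy $( * )$, then $$\int_0^{2\pi}|p_K(\theta)-p_{S(K)}(\theta)|^2\,d\theta\le C\,W .$$ (ii) Equality holds in this inequality if $K$ is a disk and the parameters satisfy $2\alpha+4\pi\delta+\mu=0$ and $\zeta=0$ (with $E\ne 0$, so that $C$ is defined). (iii) Conversely, if equality holds in this inequality and the parameters satisfy $( * )$ and $\lambda^2+\xi^2+\zeta^2>0$, then $K$ is a disk.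
   Context: Let $\theta$ be the angle between the $x$-axis and the outward normal vector of $\gamma$. The support function of a compact convex set $K$ is $p_K(\theta)=\max_{x\in K}\langle x,(\cos\theta,\sin\theta)\rangle$; here it is $2\pi$-periodic and smooth, and $\gamma$ is parametrized by $\gamma(\theta)=(p_K\cos\theta-p_K'\sin\theta,\ p_K\sin\theta+p_K'\cos\theta)$. Notation: - $\kappa=1/(p_K+p_K'')$ is the curvature of $\gamma$, and $\rho(\theta)=1/\kappa(\theta)=p_K(\theta)+p_K''(\theta)$ is its curvature radius; $\rho_M,\rho_m$ are the maximum and minimum of $\rho$ over $[0,2\pi]$. - $L=\int_0^{2\pi}\rho\,d\theta$ is the length of $\gamma$, $A=\frac12\int_0^{2\pi}(p_K^2-p_K'^2)\,d\theta$ is the area of $K$, and $ds=\rho\,d\theta$ is arclength on $\gamma$. - $\beta$ is the locus of curvature centers of $\gamma$: $\beta(\theta)=\gamma(\theta)-\rho(\theta)(\cos\theta,\sin\theta)$. $\tilde A=\frac12\oint_\beta(\beta_1\,d\beta_2-\beta_2\,d\beta_1)=\frac12\int_0^{2\pi}(p_K'^2-p_K''^2)\,d\theta$ is the oriented area enclosed by $\beta$, and $\rho_\beta(\theta)=|p_K'(\theta)+p_K'''(\theta)|$ is the curvature radius of $\beta$. - $\rho_e$ and $\rho_i$ are the circumradius of $\gamma$ (radius of the smallest disk containing $K$) and the inradius (radius of the largest disk contained in $K$). - The Steiner point of $K$ is $\frac1\pi\int_0^{2\pi}p_K(\theta)(\cos\theta,\sin\theta)\,d\theta\in\mathbb{R}^2$.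 The Steiner disk $S(K)$ is the disk centered at the Steiner point with radius $L/(2\pi)$, and $p_{S(K)}$ is its support function. *)

theory Defs
  imports "HOL-Analysis.Analysis"
begin

definition smooth_curve :: "(real \<Rightarrow> 'a::real_normed_vector) \<Rightarrow> bool" where
  "smooth_curve c \<longleftrightarrow>
     (\<forall>n t. ((\<lambda>f s. vector_derivative f (at s)) ^^ n) c differentiable (at t))"

definition signed_curvature :: "(real \<Rightarrow> real^2) \<Rightarrow> real \<Rightarrow> real" where
  "signed_curvature c t =
     (let v = vector_derivative c (at t);
          a = vector_derivative (\<lambda>s. vector_derivative c (at s)) (at t)
      in (v $ 1 * a $ 2 - v $ 2 * a $ 1) / norm v ^ 3)"

(* The curve is given by a T-periodic parametrization on the whole line, so that it is smooth
   also where it closes up.  Positivity of the signed curvature fixes the counterclockwise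
   orientation; this is no restriction on K, since a curve can be reversed. *)
definition bounded_by_smooth_pos_curved_curve :: "(real^2) set \<Rightarrow> bool" where
  "bounded_by_smooth_pos_curved_curve K \<longleftrightarrow>
     (\<exists>c T. T > 0 \<and> smooth_curve c \<and>
            (\<forall>t. c (t + T) = c t) \<and> inj_on c {0..<T} \<and>
            (\<forall>t. vector_derivative c (at t) \<noteq> 0) \<and>
            (\<forall>t. signed_curvature c t > 0) \<and>
            frontier K = c ` {0..T})"

definition strictly_convex_domain :: "(real^2) set \<Rightarrow> bool" where
  "strictly_convex_domain K \<longleftrightarrow>
     compact K \<and> convex K \<and> interior K \<noteq> {} \<and>
     (\<forall>x\<in>K. \<forall>y\<in>K. x \<noteq> y \<longrightarrow> open_segment x y \<subseteq> interior K)"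

definition is_disk :: "(real^2) set \<Rightarrow> bool" where
  "is_disk K \<longleftrightarrow> (\<exists>x r. r > 0 \<and> K = cball x r)"

definition normal_dir :: "real \<Rightarrow> real^2" where
  "normal_dir \<theta> = vector [cos \<theta>, sin \<theta>]"

definition support_fun :: "(real^2) set \<Rightarrow> real \<Rightarrow> real" where
  "support_fun K \<theta> = (SUP x\<in>K. x \<bullet> normal_dir \<theta>)"

definition boundary_curve :: "(real^2) set \<Rightarrow> real \<Rightarrow> real^2" where
  "boundary_curve K \<theta> =
     vector [support_fun K \<theta> * cos \<theta> - deriv (support_fun K) \<theta> * sin \<theta>,
             support_fun K \<theta> * sin \<theta> + deriv (support_fun K) \<theta> * cos \<theta>]"

definition curvature :: "(real^2) set \<Rightarrow> real \<Rightarrow> real" where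
  "curvature K \<theta> = 1 / (support_fun K \<theta> + deriv (deriv (support_fun K)) \<theta>)"

definition curv_radius :: "(real^2) set \<Rightarrow> real \<Rightarrow> real" where
  "curv_radius K \<theta> = 1 / curvature K \<theta>"

definition curv_radius_max :: "(real^2) set \<Rightarrow> real" where
  "curv_radius_max K = (SUP \<theta>\<in>{0..2*pi}. curv_radius K \<theta>)"

definition curv_radius_min :: "(real^2) set \<Rightarrow> real" where
  "curv_radius_min K = (INF \<theta>\<in>{0..2*pi}. curv_radius K \<theta>)"

(* Cauchy's formulas for length and area in terms of the support function. *)
definition perimeter :: "(real^2) set \<Rightarrow> real" where
  "perimeter K = integral {0..2*pi} (curv_radius K)"

definition area :: "(real^2) set \<Rightarrow> real" where
  "area K = 1/2 * integral {0..2*pi}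
     (\<lambda>\<theta>. (support_fun K \<theta>)\<^sup>2 - (deriv (support_fun K) \<theta>)\<^sup>2)"

definition evolute :: "(real^2) set \<Rightarrow> real \<Rightarrow> real^2" where
  "evolute K \<theta> = boundary_curve K \<theta> - curv_radius K \<theta> *\<^sub>R normal_dir \<theta>"

definition evolute_area :: "(real^2) set \<Rightarrow> real" where
  "evolute_area K = 1/2 * integral {0..2*pi}
     (\<lambda>\<theta>. let \<beta> = evolute K \<theta>; \<beta>' = vector_derivative (evolute K) (at \<theta>)
          in \<beta> $ 1 * \<beta>' $ 2 - \<beta> $ 2 * \<beta>' $ 1)"

definition evolute_curv_radius :: "(real^2) set \<Rightarrow> real \<Rightarrow> real" where
  "evolute_curv_radius K \<theta> =
     \<bar>deriv (support_fun K) \<theta> + deriv (deriv (deriv (support_fun K))) \<theta>\<bar>"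

(* The line integral of the squared curvature over the boundary, with ds = rho d theta. *)
definition curvature_energy :: "(real^2) set \<Rightarrow> real" where
  "curvature_energy K = integral {0..2*pi} (\<lambda>\<theta>. (curvature K \<theta>)\<^sup>2 * curv_radius K \<theta>)"

definition circumradius :: "(real^2) set \<Rightarrow> real" where
  "circumradius K = Inf {r. r \<ge> 0 \<and> (\<exists>x. K \<subseteq> cball x r)}"

definition inradius :: "(real^2) set \<Rightarrow> real" where
  "inradius K = Sup {r. r \<ge> 0 \<and> (\<exists>x. cball x r \<subseteq> K)}"

definition steiner_point :: "(real^2) set \<Rightarrow> real^2" where
  "steiner_point K =
     (1 / pi) *\<^sub>R integral {0..2*pi} (\<lambda>\<theta>. support_fun K \<theta> *\<^sub>R normal_dir \<theta>)"

definition steiner_disk :: "(real^2) set \<Rightarrow> (real^2) set" where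
  "steiner_disk K = cball (steiner_point K) (perimeter K / (2 * pi))"

end

theory Submission
  imports Defs
begin

text \<open>Write the support function as \<open>p = a0 + l + h\<close>, where \<open>a0 = L / (2 \<pi>)\<close> is its mean, \<open>l\<close> its
first harmonic (the support function of the Steiner point) and \<open>h\<close> collects the harmonics of order
at least two. The distance to be estimated is \<open>A0 = \<integral>h\<^sup>2\<close>, and with \<open>Ak\<close> the integral of the squared
\<open>k\<close>-th derivative of \<open>h\<close>, the integral of \<open>\<rho>\<^sup>2\<close>, the area, the evolute area and the integral of the
squared curvature radius of the evolute are linear in \<open>a0\<^sup>2, A0, A1, A2, A3\<close>. In Fourier terms
\<open>Ak = \<Sum> n\<^sup>2\<^sup>k q\<^sub>n\<close> with weights \<open>q\<^sub>n \<ge> 0\<close> supported on \<open>n \<ge> 2\<close>.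

Since \<open>2 \<pi> W - 3 E A0\<close> is linear in the parameters, it can be rewritten in the sign-constrained
quantities that occur in the hypotheses, namely \<open>u = 2\<alpha> + 4\<pi>\<delta> + \<mu> - 4\<zeta>\<close>, \<open>v = 2\<alpha> + \<sigma> - 2\<eta> - 4\<zeta>\<close>, \<open>E\<close>, \<open>\<eta>\<close>,
\<open>- lam\<close>, \<open>\<xi>\<close> and \<open>\<zeta>\<close>. One dimension of parameters drops out because \<open>\<integral>\<rho>\<^sup>2 = 2 A + 2 |evolute area|\<close>. The
result (deficit_decomposition) is a sum of seven terms, each of which is a nonnegative parameter
times a nonnegative quantity:

\<^item> the coefficients of \<open>E\<close>, \<open>v\<close> and \<open>\<eta>\<close> have the symbols \<open>n\<^sup>2 - 4\<close>, \<open>(n\<^sup>2 - 1)(n\<^sup>2 - 4)\<close> and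
  \<open>(n\<^sup>2 - 1)(n\<^sup>2 - 4)(n\<^sup>2 + 4)\<close>, all nonnegative for \<open>n \<ge> 2\<close> (higher_harmonics.wirtinger,
  higher_harmonics.second_order, higher_harmonics.third_order);
\<^item> the coefficient of \<open>- lam\<close> is nonnegative by Bonnesen's inequality
  \<open>L\<^sup>2 - 4 \<pi> A \<ge> \<pi>\<^sup>2 (\<rho>\<^sub>e - \<rho>\<^sub>i)\<^sup>2\<close> (smooth_oval.bonnesen);
\<^item> the coefficient of \<open>\<xi>\<close> is nonnegative since the variance of \<open>\<rho>\<close> is at most a quarter of its
  squared oscillation (popoviciu) and dominates the isoperimetric deficit;
\<^item> the coefficients of \<open>u\<close> and \<open>\<zeta>\<close> are positive because \<open>L > 0\<close>.

Bonnesen's inequality and the inequalities between the \<open>Ak\<close> are obtained without Fourier series, from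
the estimate \<open>\<integral>f\<^sup>2 \<le> \<integral>f'\<^sup>2\<close> for functions vanishing at the endpoints of an interval of length at most \<open>\<pi>\<close>
(wirtinger_dirichlet). It yields the estimate for periodic functions with a zero in every half
period, hence Bonnesen's inequality, because the contact directions of the circumscribed and the
inscribed disk meet every closed half circle; it yields Wirtinger's inequality for mean zero
functions, and from this the sharper constant for \<open>h\<close>.

In the equality case with \<open>(lam, \<xi>, \<zeta>) \<noteq> 0\<close>, all seven terms vanish. Thus \<open>\<zeta> = 0\<close> and \<open>A1 = 4 A0\<close>.
If \<open>\<xi> \<noteq> 0\<close>, the estimate for \<open>\<xi>\<close> has a slack factor of three, which forces \<open>A0 = 0\<close>. If \<open>lam \<noteq> 0\<close>,
the function \<open>h\<close> is a pure second harmonic of some amplitude \<open>B\<close>; then \<open>(\<rho>\<^sub>e - \<rho>\<^sub>i)\<^sup>2 \<le> 4 B\<^sup>2\<close>, while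
equality in Bonnesen's inequality says \<open>(\<rho>\<^sub>e - \<rho>\<^sub>i)\<^sup>2 = 6 B\<^sup>2\<close>, so \<open>B = 0\<close>. Finally \<open>A0 = 0\<close> means that
\<open>K\<close> is its own Steiner disk.

That the support function has three continuous derivatives and \<open>p + p'' > 0\<close> is derived from the
given boundary curve (smooth_support_fun), by passing from the parameter of the curve to the
direction of its outer normal.\<close>

section \<open>Calculus of continuously differentiable periodic functions\<close>

text \<open>The derivative is an explicit argument, so that periodicity and continuity of a function and of its
derivatives are carried through algebraic combinations by the rules C1_periodic_intros. The period is
always \<open>2 \<pi>\<close>.\<close>
definition C1_periodic :: "(real \<Rightarrow> real) \<Rightarrow> (real \<Rightarrow> real) \<Rightarrow> bool" where
  "C1_periodic f f' \<longleftrightarrow> (\<forall>x. (f has_real_derivative f' x) (at x)) \<and> continuous_on UNIV f'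
     \<and> (\<forall>x. f (x + 2 * pi) = f x)"

abbreviation circint :: "(real \<Rightarrow> real) \<Rightarrow> real" where
  "circint f \<equiv> integral {0..2 * pi} f"

lemma C1_periodicD:
  assumes "C1_periodic f f'"
  shows "(f has_real_derivative f' x) (at x)" "continuous_on S f'" "continuous_on S f"
    "f (x + 2 * pi) = f x" "f' (x + 2 * pi) = f' x"
proof -
  show d: "(f has_real_derivative f' x) (at x)" for x
    using assms by (auto simp: C1_periodic_def)
  show "continuous_on S f'"
    using assms by (auto simp: C1_periodic_def intro: continuous_on_subset)
  show "continuous_on S f"
    using d by (meson DERIV_isCont continuous_at_imp_continuous_on)
  show "f (x + 2 * pi) = f x"
    using assms by (auto simp: C1_periodic_def)
  have "((\<lambda>x. f (x + 2 * pi)) has_real_derivative f' (x + 2 * pi)) (at x)"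
    using DERIV_shift d by blast
  moreover have "(\<lambda>x. f (x + 2 * pi)) = f"
    using assms by (auto simp: C1_periodic_def)
  ultimately show "f' (x + 2 * pi) = f' x"
    using d[of x] DERIV_unique by metis
qed

lemma C1_periodic_const: "C1_periodic (\<lambda>x. c) (\<lambda>x. 0)"
  by (auto simp: C1_periodic_def)

lemma C1_periodic_cos: "C1_periodic cos (\<lambda>x. - sin x)"
  by (auto simp: C1_periodic_def intro!: continuous_intros derivative_eq_intros)

lemma C1_periodic_sin: "C1_periodic sin cos"
  by (auto simp: C1_periodic_def intro!: continuous_intros derivative_eq_intros)

lemma C1_periodic_minus:
  assumes "C1_periodic f f'"
  shows "C1_periodic (\<lambda>x. - f x) (\<lambda>x. - f' x)"
  using assms by (auto simp: C1_periodic_def intro!: continuous_intros derivative_eq_intros)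

lemma C1_periodic_add:
  assumes "C1_periodic f f'" "C1_periodic g g'"
  shows "C1_periodic (\<lambda>x. f x + g x) (\<lambda>x. f' x + g' x)"
  using assms by (auto simp: C1_periodic_def intro!: continuous_intros derivative_eq_intros)

lemma C1_periodic_diff:
  assumes "C1_periodic f f'" "C1_periodic g g'"
  shows "C1_periodic (\<lambda>x. f x - g x) (\<lambda>x. f' x - g' x)"
  using assms by (auto simp: C1_periodic_def intro!: continuous_intros derivative_eq_intros)

lemma C1_periodic_mult:
  assumes "C1_periodic f f'" "C1_periodic g g'"
  shows "C1_periodic (\<lambda>x. f x * g x) (\<lambda>x. f' x * g x + f x * g' x)"
  using C1_periodicD[OF assms(1)] C1_periodicD[OF assms(2)] unfolding C1_periodic_def
  by (auto intro!: continuous_intros derivative_eq_intros)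

lemma C1_periodic_cmult:
  assumes "C1_periodic f f'"
  shows "C1_periodic (\<lambda>x. c * f x) (\<lambda>x. c * f' x)"
  using C1_periodic_mult[OF C1_periodic_const assms] by simp

lemmas C1_periodic_intros = C1_periodic_const C1_periodic_cos C1_periodic_sin C1_periodic_minus
  C1_periodic_add C1_periodic_diff C1_periodic_mult C1_periodic_cmult

lemma circint_add:
  assumes "continuous_on UNIV f" "continuous_on UNIV g"
  shows "circint (\<lambda>x. f x + g x) = circint f + circint g"
  using assms by (intro integral_add integrable_continuous_real) (auto intro: continuous_on_subset)

lemma circint_diff:
  assumes "continuous_on UNIV f" "continuous_on UNIV g"
  shows "circint (\<lambda>x. f x - g x) = circint f - circint g"
  using assms by (intro integral_diff integrable_continuous_real) (auto intro: continuous_on_subset)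

lemmas circint_simps = circint_add circint_diff continuous_intros

lemma circint_mono:
  assumes "continuous_on UNIV f" "continuous_on UNIV g" "\<And>x. f x \<le> g x"
  shows "circint f \<le> circint g"
  using assms by (intro integral_le integrable_continuous_real) (auto intro: continuous_on_subset)

lemma circint_nonneg:
  assumes "continuous_on UNIV f" "\<And>x. 0 \<le> f x"
  shows "0 \<le> circint f"
  using circint_mono[OF continuous_on_const assms(1), of 0] assms(2) by simp

lemma circint_derivative:
  assumes "C1_periodic f f'"
  shows "circint f' = 0"
proof -
  have "(f' has_integral f (2 * pi) - f 0) {0..2 * pi}"
    using C1_periodicD(1)[OF assms]
    by (intro fundamental_theorem_of_calculus)
      (auto simp: has_real_derivative_iff_has_vector_derivative[symmetric]
        intro: DERIV_subset)
  thus ?thesis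
    using C1_periodicD(4)[OF assms, of 0] by auto
qed

lemma circint_trig:
  "circint cos = 0" "circint sin = 0" "circint (\<lambda>x. cos x * sin x) = 0"
  "circint (\<lambda>x. cos x * cos x) = pi" "circint (\<lambda>x. sin x * sin x) = pi"
proof -
  show "circint cos = 0"
    using circint_derivative[OF C1_periodic_sin] .
  show "circint sin = 0"
    using circint_derivative[OF C1_periodic_minus[OF C1_periodic_cos]] by simp
  have "circint (\<lambda>x. cos x * sin x + sin x * cos x) = 0"
    using circint_derivative[OF C1_periodic_mult[OF C1_periodic_sin C1_periodic_sin]] .
  hence "circint (\<lambda>x. 2 * (cos x * sin x)) = 0"
    by (simp add: mult.commute)
  thus "circint (\<lambda>x. cos x * sin x) = 0"
    by simp
  have 1: "circint (\<lambda>x. cos x * cos x - sin x * sin x) = 0"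
    using circint_derivative[OF C1_periodic_mult[OF C1_periodic_cos C1_periodic_sin]]
    by (simp add: algebra_simps)
  have 2: "circint (\<lambda>x. cos x * cos x + sin x * sin x) = 2 * pi"
    using sin_cos_squared_add[unfolded power2_eq_square] by (simp add: add.commute)
  have 3: "circint (\<lambda>x. cos x * cos x) - circint (\<lambda>x. sin x * sin x) = 0"
    using 1 by (subst (asm) circint_diff) (auto intro!: continuous_intros)
  have 4: "circint (\<lambda>x. cos x * cos x) + circint (\<lambda>x. sin x * sin x) = 2 * pi"
    using 2 by (subst (asm) circint_add) (auto intro!: continuous_intros)
  show "circint (\<lambda>x. cos x * cos x) = pi" "circint (\<lambda>x. sin x * sin x) = pi"
    using 3 4 by auto
qed

lemma circint_by_parts:
  assumes "C1_periodic f f'" "C1_periodic g g'"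
  shows "circint (\<lambda>x. f' x * g x) = - circint (\<lambda>x. f x * g' x)"
proof -
  note [simp] = C1_periodicD(2,3)[OF assms(1)] C1_periodicD(2,3)[OF assms(2)]
  have "0 = circint (\<lambda>x. f' x * g x + f x * g' x)"
    using circint_derivative[OF C1_periodic_mult[OF assms]] by simp
  also have "\<dots> = circint (\<lambda>x. f' x * g x) + circint (\<lambda>x. f x * g' x)"
    by (intro circint_add continuous_intros) auto
  finally show ?thesis by simp
qed

lemma continuous_has_antiderivative:
  fixes f :: "real \<Rightarrow> real"
  assumes "continuous_on UNIV f"
  obtains F where "\<And>x. (F has_real_derivative f x) (at x)"
proof -
  have "\<exists>F. \<forall>x::real. -\<infinity> < ereal x \<longrightarrow> ereal x < \<infinity> \<longrightarrow> (F has_vector_derivative f x) (at x)"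
    by (rule einterval_antiderivative) (use assms in \<open>auto simp: continuous_on_eq_continuous_at\<close>)
  thus ?thesis
    using that by (auto simp: has_real_derivative_iff_has_vector_derivative)
qed

text \<open>Differentiating in the left endpoint, the integral over a full period does not depend on where the
period starts.\<close>
lemma circint_shift:
  assumes "continuous_on UNIV f" "\<And>x. f (x + 2 * pi) = f x"
  shows "circint f = integral {a..a + 2 * pi} f"
proof -
  obtain F where F: "\<And>x. (F has_real_derivative f x) (at x)"
    using continuous_has_antiderivative[OF assms(1)] by blast
  have I: "integral {b..b + 2 * pi} f = F (b + 2 * pi) - F b" for b
    using F by (intro integral_unique fundamental_theorem_of_calculus)
      (auto simp: has_real_derivative_iff_has_vector_derivative[symmetric] intro: DERIV_subset)
  have "((\<lambda>b. F (b + 2 * pi) - F b) has_real_derivative f (b + 2 * pi) - f b) (at b)" for b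
    using F DERIV_shift[of F] by (auto intro!: DERIV_diff)
  hence "\<forall>b. ((\<lambda>b. F (b + 2 * pi) - F b) has_real_derivative 0) (at b)"
    by (simp add: assms(2))
  from DERIV_isconst_all[OF this, of a 0] show ?thesis
    using I[of 0] I[of a] by simp
qed

lemma periodic_shift_int:
  fixes f :: "real \<Rightarrow> 'a"
  assumes "\<And>x. f (x + T) = f x"
  shows "f (x + of_int k * T) = f x"
proof (induction k rule: int_induct[where k=0])
  case base thus ?case by simp
next
  case (step1 i)
  thus ?case using assms[of "x + of_int i * T"] by (simp add: algebra_simps)
next
  case (step2 i)
  thus ?case using assms[of "x + of_int (i - 1) * T"] by (simp add: algebra_simps)
qed

lemma periodic_reduce:
  fixes f :: "real \<Rightarrow> 'a"
  assumes "\<And>x. f (x + T) = f x" "0 < T"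
  obtains y where "a \<le> y" "y \<le> a + T" "f x = f y"
proof -
  define k where "k = \<lceil>(a - x) / T\<rceil>"
  have "(a - x) / T \<le> of_int k" "of_int k \<le> (a - x) / T + 1"
    unfolding k_def by linarith+
  hence "a \<le> x + of_int k * T" "x + of_int k * T \<le> a + T"
    using assms(2) by (auto simp: field_simps)
  moreover have "f x = f (x + of_int k * T)"
    by (rule periodic_shift_int[symmetric]) (rule assms)
  ultimately show ?thesis by (rule that)
qed

section \<open>Wirtinger inequalities\<close>

text \<open>For \<open>c < 1\<close> the function \<open>T x = tan (c (x - m))\<close>, with \<open>m\<close> the midpoint, is regular on the whole closed
interval, and \<open>f'\<^sup>2 - c\<^sup>2 f\<^sup>2 = (f' + c f T)\<^sup>2 - (c f\<^sup>2 T)'\<close>. Integrating, the boundary term vanishes and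
\<open>c\<^sup>2 \<integral>f\<^sup>2 \<le> \<integral>f'\<^sup>2\<close>; then \<open>c\<close> tends to one. Working with \<open>c < 1\<close> avoids the singularities at the endpoints
that \<open>c = 1\<close> has on intervals of length exactly \<open>\<pi>\<close>.\<close>
lemma wirtinger_dirichlet:
  assumes d: "\<And>x. (f has_real_derivative f' x) (at x)" and c: "continuous_on UNIV f'"
    and z: "f a = 0" "f b = 0" and ab: "a \<le> b" "b \<le> a + pi"
  shows "integral {a..b} (\<lambda>x. (f x)\<^sup>2) \<le> integral {a..b} (\<lambda>x. (f' x)\<^sup>2)"
proof -
  have cf: "continuous_on S f" for S
    using d by (meson DERIV_isCont continuous_at_imp_continuous_on)
  have cf': "continuous_on S f'" for S
    using c by (rule continuous_on_subset) auto
  define I where "I = integral {a..b} (\<lambda>x. (f x)\<^sup>2)"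
  define J where "J = integral {a..b} (\<lambda>x. (f' x)\<^sup>2)"
  have le: "c\<^sup>2 * I \<le> J" if c: "0 < c" "c < 1" for c
  proof -
    define m where "m = (a + b) / 2"
    define T where "T x = tan (c * (x - m))" for x
    have cos: "cos (c * (x - m)) > 0" if "x \<in> {a..b}" for x
    proof -
      have "\<bar>x - m\<bar> \<le> pi / 2"
        using that ab unfolding m_def by (auto simp: abs_if field_simps)
      hence "c * \<bar>x - m\<bar> \<le> c * (pi / 2)"
        using c by (intro mult_left_mono) auto
      also have "\<dots> < pi / 2"
        using c by simp
      finally have "\<bar>c * (x - m)\<bar> < pi / 2"
        using c by (simp add: abs_mult)
      thus ?thesis by (intro cos_gt_zero_pi) auto
    qed
    have dT: "(T has_real_derivative c * (1 + (T x)\<^sup>2)) (at x)" if "x \<in> {a..b}" for x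
    proof -
      have "((\<lambda>x. tan (c * (x - m))) has_real_derivative
          inverse ((cos (c * (x - m)))\<^sup>2) * c) (at x)"
        using cos[OF that] by (auto intro!: derivative_eq_intros)
      moreover have "inverse ((cos (c * (x - m)))\<^sup>2) = 1 + (T x)\<^sup>2"
        using tan_sec[of "c * (x - m)"] cos[OF that] by (simp add: T_def power_inverse)
      ultimately show ?thesis
        unfolding T_def[abs_def] by (simp add: mult.commute)
    qed
    have "((\<lambda>x. (f' x + c * f x * T x)\<^sup>2 + (c\<^sup>2 * (f x)\<^sup>2 - (f' x)\<^sup>2)) has_integral
        c * ((f b)\<^sup>2 * T b) - c * ((f a)\<^sup>2 * T a)) {a..b}"
      using ab(1)
    proof (intro fundamental_theorem_of_calculus)
      fix x assume x: "x \<in> {a..b}"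
      have "((\<lambda>x. c * ((f x)\<^sup>2 * T x)) has_real_derivative
          c * (2 * f x * f' x * T x + (f x)\<^sup>2 * (c * (1 + (T x)\<^sup>2)))) (at x)"
        using d dT[OF x] by (auto intro!: derivative_eq_intros simp: algebra_simps)
      moreover have "c * (2 * f x * f' x * T x + (f x)\<^sup>2 * (c * (1 + (T x)\<^sup>2)))
          = (f' x + c * f x * T x)\<^sup>2 + (c\<^sup>2 * (f x)\<^sup>2 - (f' x)\<^sup>2)"
        by (simp add: power2_eq_square algebra_simps)
      ultimately show "((\<lambda>x. c * ((f x)\<^sup>2 * T x)) has_vector_derivative
          (f' x + c * f x * T x)\<^sup>2 + (c\<^sup>2 * (f x)\<^sup>2 - (f' x)\<^sup>2)) (at x within {a..b})"
        by (auto simp: has_real_derivative_iff_has_vector_derivative[symmetric]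
            intro: has_field_derivative_at_within)
    qed
    hence 1: "((\<lambda>x. (f' x + c * f x * T x)\<^sup>2 + (c\<^sup>2 * (f x)\<^sup>2 - (f' x)\<^sup>2)) has_integral 0) {a..b}"
      using z by simp
    have "((\<lambda>x. c\<^sup>2 * (f x)\<^sup>2 - (f' x)\<^sup>2) has_integral c\<^sup>2 * I - J) {a..b}"
      unfolding I_def J_def
      by (intro has_integral_diff has_integral_mult_right integrable_integral
          integrable_continuous_real continuous_intros cf cf')
    from this 1 have "c\<^sup>2 * I - J \<le> 0"
      by (rule has_integral_le) auto
    thus ?thesis by simp
  qed
  have "((\<lambda>c. c\<^sup>2 * I) \<longlongrightarrow> 1\<^sup>2 * I) (at_left 1)"
    by (intro tendsto_intros)
  moreover have "\<forall>\<^sub>F c::real in at_left 1. 0 < c \<and> c < 1"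
    using eventually_at_left_real[of "0::real" 1] by (rule eventually_mono) auto
  hence "\<forall>\<^sub>F c in at_left 1. c\<^sup>2 * I \<le> J"
    by (rule eventually_mono) (use le in auto)
  ultimately have "1\<^sup>2 * I \<le> J"
    by (rule tendsto_upperbound) auto
  thus ?thesis by (simp add: I_def J_def)
qed

text \<open>Zeros of \<open>f\<close> can be chosen greedily: from a zero \<open>t0\<close> go to the last zero \<open>t1\<close> in \<open>[t0, t0 + \<pi>]\<close>, and from
there to the last zero \<open>t2\<close> in \<open>[t1, t1 + \<pi>]\<close>. A half period without zeros does not exist, so \<open>t2\<close> lies
beyond \<open>t0 + \<pi>\<close>, and at most three intervals of length at most \<open>\<pi>\<close> between zeros fill a whole period.\<close>
lemma wirtinger_zeros:
  assumes f: "C1_periodic f f'" and z: "\<And>a. \<exists>x\<in>{a..a + pi}. f x = 0"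
  shows "circint (\<lambda>x. (f x)\<^sup>2) \<le> circint (\<lambda>x. (f' x)\<^sup>2)"
proof -
  note cont = C1_periodicD(2,3)[OF f]
  have closed: "compact {x \<in> {a..b}. f x = 0}" for a b
  proof -
    have "{x \<in> {a..b}. f x = 0} = {a..b} \<inter> f -` {0}" by auto
    thus ?thesis
      using continuous_closed_preimage[OF cont(2), of "{a..b}" "{0}"]
      by (metis Int_lower1 closed_singleton closed_real_atLeastAtMost compact_Icc
          compact_Int_closed inf_left_idem)
  qed
  have last_zero: "\<exists>t. f t = 0 \<and> a \<le> t \<and> t \<le> a + pi \<and> (\<forall>x. f x = 0 \<longrightarrow> x \<le> a + pi \<longrightarrow> x \<le> t)"
    if "f a = 0" for a
  proof -
    have "{x \<in> {a..a+pi}. f x = 0} \<noteq> {}" using that pi_ge_zero by fastforce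
    from compact_attains_sup[OF closed this] obtain t where
      t: "f t = 0" "a \<le> t" "t \<le> a + pi" "\<And>x. x \<in> {a..a+pi} \<Longrightarrow> f x = 0 \<Longrightarrow> x \<le> t"
      by auto
    have "x \<le> t" if "f x = 0" "x \<le> a + pi" for x
      using t that by (cases "a \<le> x") auto
    thus ?thesis using t by blast
  qed
  have next_zero: "\<exists>x. f x = 0 \<and> u < x \<and> x \<le> u + pi" if u: "\<And>x. f x = 0 \<Longrightarrow> x \<le> u + pi \<Longrightarrow> x \<le> u" for u
  proof -
    have ne: "{x \<in> {u + pi..u + 2*pi}. f x = 0} \<noteq> {}"
    proof -
      obtain x where "x \<in> {u + pi..u + pi + pi}" "f x = 0"
        using z[of "u + pi"] by blast
      thus ?thesis by (intro ex_in_conv[THEN iffD1] exI[of _ x]) auto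
    qed
    from compact_attains_inf[OF closed ne] obtain t where
      t: "f t = 0" "u + pi \<le> t" "\<And>x. x \<in> {u + pi..u + 2*pi} \<Longrightarrow> f x = 0 \<Longrightarrow> t \<le> x"
      by auto
    have "u + pi < t"
      using t u[of t] pi_gt_zero by (cases "t = u + pi") auto
    \<comment> \<open>The half period that starts slightly after \<open>u\<close> still ends before \<open>t\<close>, the first zero from \<open>u + \<pi>\<close> on.\<close>
    define e where "e = min (t - u - pi) pi / 2"
    have e: "e > 0" "u + pi + e < t" "e < pi"
      using \<open>u + pi < t\<close> by (auto simp: e_def min_def field_simps)
    obtain x where x: "f x = 0" "u + e \<le> x" "x \<le> u + e + pi"
      using z[of "u + e"] by auto
    have "x > u + pi" using u[OF x(1)] x e by force
    hence "t \<le> x" using x e by (intro t(3)) auto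
    thus ?thesis using x e by auto
  qed
  have step: "integral {a..b} (\<lambda>x. (f x)\<^sup>2) \<le> integral {a..b} (\<lambda>x. (f' x)\<^sup>2)"
    if "f a = 0" "f b = 0" "a \<le> b" "b \<le> a + pi" for a b
    using that C1_periodicD(1)[OF f] cont(1) by (intro wirtinger_dirichlet)
  have glue: "integral {a..c} (\<lambda>x. (f x)\<^sup>2) \<le> integral {a..c} (\<lambda>x. (f' x)\<^sup>2)"
    if "integral {a..b} (\<lambda>x. (f x)\<^sup>2) \<le> integral {a..b} (\<lambda>x. (f' x)\<^sup>2)"
      "integral {b..c} (\<lambda>x. (f x)\<^sup>2) \<le> integral {b..c} (\<lambda>x. (f' x)\<^sup>2)" "a \<le> b" "b \<le> c" for a b c
  proof -
    have comb: "integral {a..b} u + integral {b..c} u = integral {a..c} u"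
      if "continuous_on {a..c} u" for u :: "real \<Rightarrow> real"
      using \<open>a \<le> b\<close> \<open>b \<le> c\<close> that
      by (intro Henstock_Kurzweil_Integration.integral_combine integrable_continuous_real)
    have "continuous_on {a..c} (\<lambda>x. (f x)\<^sup>2)" "continuous_on {a..c} (\<lambda>x. (f' x)\<^sup>2)"
      by (intro continuous_intros cont)+
    from comb[OF this(1)] comb[OF this(2)] show ?thesis
      using that by linarith
  qed
  obtain t0 where t0: "f t0 = 0" using z by blast
  obtain t1 where t1: "f t1 = 0" "t0 \<le> t1" "t1 \<le> t0 + pi"
    "\<And>x. f x = 0 \<Longrightarrow> x \<le> t0 + pi \<Longrightarrow> x \<le> t1"
    using last_zero[OF t0] by blast
  obtain t2 where t2: "f t2 = 0" "t1 \<le> t2" "t2 \<le> t1 + pi"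
    "\<And>x. f x = 0 \<Longrightarrow> x \<le> t1 + pi \<Longrightarrow> x \<le> t2"
    using last_zero[OF t1(1)] by blast
  have t12: "t0 + pi < t2"
  proof -
    obtain x where "f x = 0" "x > t1" "x \<le> t1 + pi"
      using next_zero[of t1] t2 by force
    moreover have "x > t0 + pi" using t1(4)[of x] calculation by force
    ultimately show ?thesis using t2(4)[of x] by auto
  qed
  have t3: "f (t0 + 2 * pi) = 0"
    using C1_periodicD(4)[OF f] t0 by simp
  have "integral {t0..t0 + 2 * pi} (\<lambda>x. (f x)\<^sup>2) \<le> integral {t0..t0 + 2 * pi} (\<lambda>x. (f' x)\<^sup>2)"
  proof (cases "t2 < t0 + 2 * pi")
    case True
    have "t0 + 2 * pi \<le> t2 + pi" using t12 by linarith
    with True have "integral {t1..t0 + 2 * pi} (\<lambda>x. (f x)\<^sup>2) \<le> integral {t1..t0 + 2 * pi} (\<lambda>x. (f' x)\<^sup>2)"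
      by (intro glue[OF step[OF t1(1) t2(1-3)] step[OF t2(1) t3]] t2(2)) linarith+
    thus ?thesis
      by (rule glue[OF step[OF t0 t1(1-3)]]) (use True t1(2) t2(2) in linarith)+
  next
    case False
    hence "t1 \<le> t0 + 2 * pi" "t0 + 2 * pi \<le> t1 + pi"
      using t1(3) t2(3) pi_gt_zero by linarith+
    from glue[OF step[OF t0 t1(1-3)] step[OF t1(1) t3 this] t1(2) this(1)] show ?thesis .
  qed
  moreover have "circint (\<lambda>x. (f x)\<^sup>2) = integral {t0..t0 + 2 * pi} (\<lambda>x. (f x)\<^sup>2)"
    by (intro circint_shift continuous_intros cont) (simp add: C1_periodicD(4)[OF f])
  moreover have "circint (\<lambda>x. (f' x)\<^sup>2) = integral {t0..t0 + 2 * pi} (\<lambda>x. (f' x)\<^sup>2)"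
    by (intro circint_shift continuous_intros cont) (simp add: C1_periodicD(5)[OF f])
  ultimately show ?thesis by simp
qed

text \<open>The function \<open>x \<mapsto> f x - f (x + \<pi>)\<close> changes sign on a half period, so \<open>f\<close> takes one value \<open>c\<close> at two
points at distance \<open>\<pi>\<close>. Then \<open>f - c\<close> has a zero in every half period, and subtracting a constant
from a mean zero function only increases the integral of its square.\<close>
lemma wirtinger_mean_zero:
  assumes f: "C1_periodic f f'" and m: "circint f = 0"
  shows "circint (\<lambda>x. (f x)\<^sup>2) \<le> circint (\<lambda>x. (f' x)\<^sup>2)"
proof -
  note cont = C1_periodicD(2,3)[OF f]
  have "\<exists>x. 0 \<le> x \<and> x \<le> pi \<and> f x - f (x + pi) = 0"
  proof -
    define d where "d x = f x - f (x + pi)" for x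
    have shift: "continuous_on {0..pi} (\<lambda>x. f (x + pi))"
      by (rule continuous_on_compose2[OF cont(2)[of UNIV]]) (auto intro!: continuous_intros)
    have c: "continuous_on {0..pi} d"
      unfolding d_def by (intro continuous_intros cont shift)
    have s: "d pi = - d 0"
      using C1_periodicD(4)[OF f, of 0] by (simp add: d_def)
    show ?thesis
    proof (cases "d 0 \<le> 0")
      case True
      thus ?thesis using IVT'[of d 0 0 pi] s c pi_ge_zero by (auto simp: d_def)
    next
      case False
      thus ?thesis using IVT2'[of d pi 0 0] s c pi_ge_zero by (auto simp: d_def)
    qed
  qed
  then obtain t where t: "f t = f (t + pi)" by auto
  define c where "c = f t"
  define g where "g x = f x - c" for x
  have g: "C1_periodic g f'"
    using C1_periodic_diff[OF f C1_periodic_const[of c]] by (simp add: g_def[abs_def])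
  have gn: "g (t + of_int k * pi) = 0" for k :: int
  proof -
    have per: "g (x + of_int k * (2 * pi)) = g x" for x and k :: int
      by (intro periodic_shift_int C1_periodicD(4)[OF g])
    have 0: "g t = 0" "g (t + pi) = 0"
      using t by (auto simp: g_def c_def)
    show ?thesis
    proof (cases "even k")
      case True
      then obtain j where "k = 2 * j" by auto
      thus ?thesis using per[of t j] 0 by (simp add: algebra_simps)
    next
      case False
      then obtain j where "k = 2 * j + 1" by (auto elim: oddE)
      thus ?thesis using per[of "t + pi" j] 0 by (simp add: algebra_simps)
    qed
  qed
  have "\<exists>x\<in>{a..a + pi}. g x = 0" for a
  proof -
    define k where "k = \<lceil>(a - t) / pi\<rceil>"
    have "(a - t) / pi \<le> of_int k" "of_int k \<le> (a - t) / pi + 1"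
      unfolding k_def by linarith+
    hence "a \<le> t + of_int k * pi" "t + of_int k * pi \<le> a + pi"
      by (auto simp: field_simps)
    thus ?thesis
      using gn[of k] by (intro bexI[of _ "t + of_int k * pi"]) auto
  qed
  from wirtinger_zeros[OF g this]
  have 1: "circint (\<lambda>x. (g x)\<^sup>2) \<le> circint (\<lambda>x. (f' x)\<^sup>2)" .
  have "circint (\<lambda>x. (g x)\<^sup>2) = circint (\<lambda>x. (f x)\<^sup>2 - 2 * c * f x + c\<^sup>2)"
    by (simp add: g_def power2_eq_square algebra_simps)
  also have "\<dots> = circint (\<lambda>x. (f x)\<^sup>2) - 2 * c * circint f + 2 * pi * c\<^sup>2"
    by (simp add: circint_simps cont)
  finally have "circint (\<lambda>x. (f x)\<^sup>2) \<le> circint (\<lambda>x. (g x)\<^sup>2)"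
    using m by simp
  with 1 show ?thesis by simp
qed

text \<open>The improvement from one to four is obtained by multiplying with the first harmonic. Let \<open>H\<close> be the
mean zero primitive of \<open>h\<close>. In complex notation, \<open>f2 + i f1 = e\<^sup>i\<^sup>x (H' - 2 i H)\<close>; a frequency \<open>k\<close>
of \<open>H\<close> becomes the frequency \<open>k + 1\<close> with weight \<open>k - 2\<close>, and
\<open>k = - 1\<close> is absent, so Wirtinger's inequality applies to \<open>f1\<close> and \<open>f2\<close>. Summed over \<open>k\<close> and \<open>- k\<close>, its symbol
\<open>((k + 1)\<^sup>2 - 1)(k - 2)\<^sup>2\<close> becomes \<open>2 k\<^sup>2 (k\<^sup>2 - 4)\<close>, which is the symbol of \<open>\<integral>h'\<^sup>2 - 4 \<integral>h\<^sup>2\<close>.\<close>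
lemma wirtinger_second:
  assumes h: "C1_periodic h h'" and m: "circint h = 0"
    and o: "circint (\<lambda>x. h x * cos x) = 0" "circint (\<lambda>x. h x * sin x) = 0"
  shows "4 * circint (\<lambda>x. (h x)\<^sup>2) \<le> circint (\<lambda>x. (h' x)\<^sup>2)"
proof -
  note cont = C1_periodicD(2,3)[OF h]
  obtain F where F: "\<And>x. (F has_real_derivative h x) (at x)"
    using continuous_has_antiderivative[OF cont(2)] by blast
  define H where "H x = F x - circint F / (2 * pi)" for x
  have dH: "(H has_real_derivative h x) (at x)" for x
    using F unfolding H_def by (auto intro!: derivative_eq_intros)
  have "H (x + 2 * pi) = H x" for x
  proof -
    have "integral {x..x + 2 * pi} h = H (x + 2 * pi) - H x"
      using dH by (intro integral_unique fundamental_theorem_of_calculus)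
        (auto simp: has_real_derivative_iff_has_vector_derivative[symmetric] intro: DERIV_subset)
    moreover have "integral {x..x + 2 * pi} h = 0"
      using circint_shift[OF cont(2), of x] C1_periodicD(4)[OF h] m by simp
    ultimately show ?thesis by linarith
  qed
  hence H: "C1_periodic H h"
    using dH cont by (auto simp: C1_periodic_def)
  have contF: "continuous_on S F" for S
    using F by (meson DERIV_isCont continuous_at_imp_continuous_on)
  have mH: "circint H = 0"
    unfolding H_def by (simp add: circint_simps contF)
  have oH: "circint (\<lambda>x. H x * cos x) = 0" "circint (\<lambda>x. H x * sin x) = 0"
    using circint_by_parts[OF H C1_periodic_sin] circint_by_parts[OF H C1_periodic_cos] o by simp_all
  note contH = C1_periodicD(3)[OF H]
  define f1 where "f1 x = h x * sin x - 2 * (H x * cos x)" for x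
  define f2 where "f2 x = h x * cos x + 2 * (H x * sin x)" for x
  have f1: "C1_periodic f1 (\<lambda>x. (h' x * sin x + h x * cos x) - 2 * (h x * cos x + H x * (- sin x)))"
    unfolding f1_def[abs_def] by (intro C1_periodic_intros h H)
  have f2: "C1_periodic f2 (\<lambda>x. (h' x * cos x + h x * (- sin x)) + 2 * (h x * sin x + H x * cos x))"
    unfolding f2_def[abs_def] by (intro C1_periodic_intros h H)
  have m12: "circint f1 = 0" "circint f2 = 0"
    unfolding f1_def[abs_def] f2_def[abs_def] using o oH
    by (simp_all add: circint_simps cont contH)
  have "circint (\<lambda>x. (h x)\<^sup>2 + 4 * (H x)\<^sup>2) = circint (\<lambda>x. (f1 x)\<^sup>2 + (f2 x)\<^sup>2)"
  proof (intro integral_cong)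
    fix x
    have "(f1 x)\<^sup>2 + (f2 x)\<^sup>2 = ((h x)\<^sup>2 + 4 * (H x)\<^sup>2) * ((sin x)\<^sup>2 + (cos x)\<^sup>2)"
      unfolding f1_def f2_def by algebra
    thus "(h x)\<^sup>2 + 4 * (H x)\<^sup>2 = (f1 x)\<^sup>2 + (f2 x)\<^sup>2" by simp
  qed
  also have "\<dots> = circint (\<lambda>x. (f1 x)\<^sup>2) + circint (\<lambda>x. (f2 x)\<^sup>2)"
    using C1_periodicD(3)[OF f1] C1_periodicD(3)[OF f2] by (intro circint_add continuous_intros)
  also have "\<dots> \<le> circint (\<lambda>x. ((h' x * sin x + h x * cos x) - 2 * (h x * cos x + H x * (- sin x)))\<^sup>2)
     + circint (\<lambda>x. ((h' x * cos x + h x * (- sin x)) + 2 * (h x * sin x + H x * cos x))\<^sup>2)"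
    using wirtinger_mean_zero[OF f1 m12(1)] wirtinger_mean_zero[OF f2 m12(2)] by simp
  also have "\<dots> = circint (\<lambda>x. ((h' x * sin x + h x * cos x) - 2 * (h x * cos x + H x * (- sin x)))\<^sup>2
     + ((h' x * cos x + h x * (- sin x)) + 2 * (h x * sin x + H x * cos x))\<^sup>2)"
    by (intro circint_add[symmetric] continuous_intros cont contH)
  also have "\<dots> = circint (\<lambda>x. (h' x)\<^sup>2 + 4 * (h' x * H x) + 4 * (H x)\<^sup>2 + (h x)\<^sup>2)"
  proof (intro integral_cong)
    fix x
    have "((h' x * sin x + h x * cos x) - 2 * (h x * cos x + H x * (- sin x)))\<^sup>2
     + ((h' x * cos x + h x * (- sin x)) + 2 * (h x * sin x + H x * cos x))\<^sup>2
     = ((h' x)\<^sup>2 + 4 * (h' x * H x) + 4 * (H x)\<^sup>2 + (h x)\<^sup>2) * ((sin x)\<^sup>2 + (cos x)\<^sup>2)"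
      by algebra
    thus "((h' x * sin x + h x * cos x) - 2 * (h x * cos x + H x * (- sin x)))\<^sup>2
     + ((h' x * cos x + h x * (- sin x)) + 2 * (h x * sin x + H x * cos x))\<^sup>2
     = (h' x)\<^sup>2 + 4 * (h' x * H x) + 4 * (H x)\<^sup>2 + (h x)\<^sup>2" by simp
  qed
  finally have "circint (\<lambda>x. (h x)\<^sup>2) + 4 * circint (\<lambda>x. (H x)\<^sup>2)
     \<le> circint (\<lambda>x. (h' x)\<^sup>2) + 4 * circint (\<lambda>x. h' x * H x) + 4 * circint (\<lambda>x. (H x)\<^sup>2)
       + circint (\<lambda>x. (h x)\<^sup>2)"
    by (simp add: circint_simps cont contH)
  moreover have "circint (\<lambda>x. h' x * H x) = - circint (\<lambda>x. (h x)\<^sup>2)"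
    using circint_by_parts[OF h H] by (simp add: power2_eq_square)
  ultimately show ?thesis by simp
qed

section \<open>Quadratic integral forms\<close>

lemma circint_eq_0D:
  assumes "continuous_on UNIV f" "\<And>x. f (x + 2 * pi) = f x" "\<And>x. 0 \<le> f x" "circint f = 0"
  shows "f x = 0"
proof -
  have "integral {x..x + 2 * pi} f = 0"
    using circint_shift[OF assms(1,2), of x] assms(4) by simp
  moreover have "continuous_on {x..x + 2 * pi} f"
    using assms(1) by (rule continuous_on_subset) auto
  ultimately show ?thesis
    using integral_eq_0_iff[of x "x + 2 * pi" f] assms(3) by simp
qed

text \<open>Integrate \<open>(M - g) (g - m) \<ge> 0\<close> and complete the square in \<open>M + m\<close>.\<close>
lemma popoviciu:
  assumes "continuous_on UNIV g" "circint g = 0" "\<And>x. m \<le> g x" "\<And>x. g x \<le> M"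
  shows "circint (\<lambda>x. (g x)\<^sup>2) \<le> pi / 2 * (M - m)\<^sup>2"
proof -
  have "circint (\<lambda>x. (g x)\<^sup>2) \<le> circint (\<lambda>x. (M + m) * g x - M * m)"
  proof (intro circint_mono continuous_intros assms)
    fix x
    have "0 \<le> (M - g x) * (g x - m)" using assms(3,4)[of x] by simp
    thus "(g x)\<^sup>2 \<le> (M + m) * g x - M * m" by (simp add: power2_eq_square algebra_simps)
  qed
  also have "\<dots> = - 2 * pi * (M * m)"
    by (simp add: circint_simps assms)
  also have "\<dots> \<le> pi / 2 * (M - m)\<^sup>2"
  proof -
    have "0 \<le> pi / 2 * (M + m)\<^sup>2" by simp
    thus ?thesis by (simp add: power2_eq_square algebra_simps)
  qed
  finally show ?thesis .
qed

text \<open>The first harmonic \<open>l\<close> and the constant \<open>b\<close> do not interact with \<open>h\<close> in the form \<open>\<integral>f\<^sup>2 - \<integral>f'\<^sup>2\<close>: since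
\<open>l'' = - l\<close>, all terms that contain \<open>l\<close> make up, up to sign, the derivative of the periodic
function \<open>(2 h + l + 2 b) l'\<close>, and \<open>\<integral>h = 0\<close> removes the product of \<open>h\<close> and \<open>b\<close>.
The area, the evolute area and both halves of Bonnesen's inequality are read off
from this identity.\<close>
lemma isoperimetric_form:
  assumes h: "C1_periodic h h'" and m: "circint h = 0"
  shows "circint (\<lambda>x. (h x + b + (u * cos x + v * sin x))\<^sup>2)
      - circint (\<lambda>x. (h' x + (v * cos x - u * sin x))\<^sup>2)
      = circint (\<lambda>x. (h x)\<^sup>2) - circint (\<lambda>x. (h' x)\<^sup>2) + 2 * pi * b\<^sup>2"
proof -
  note cont = C1_periodicD(2,3)[OF h]
  define l where "l x = u * cos x + v * sin x" for x
  define l' where "l' x = v * cos x - u * sin x" for x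
  have l: "C1_periodic l l'"
    using C1_periodic_add[OF C1_periodic_cmult[OF C1_periodic_cos, of u]
        C1_periodic_cmult[OF C1_periodic_sin, of v]]
    unfolding l_def[abs_def] l'_def[abs_def] by (simp add: add.commute[of "- _"])
  have l': "C1_periodic l' (\<lambda>x. - l x)"
    using C1_periodic_diff[OF C1_periodic_cmult[OF C1_periodic_cos, of v]
        C1_periodic_cmult[OF C1_periodic_sin, of u]]
    unfolding l_def[abs_def] l'_def[abs_def] by (simp add: minus_diff_commute)
  note contl = C1_periodicD(2,3)[OF l]
  \<comment> \<open>The part of the integrand that contains \<open>l\<close> is minus the derivative of the periodic function \<open>G\<close>.\<close>
  define G where "G x = (2 * h x + l x + 2 * b) * l' x" for x
  have G: "C1_periodic G (\<lambda>x. (2 * h' x + l' x + 0) * l' x + (2 * h x + l x + 2 * b) * (- l x))"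
    unfolding G_def[abs_def] by (intro C1_periodic_intros h l l')
  have "circint (\<lambda>x. (h x + b + l x)\<^sup>2) - circint (\<lambda>x. (h' x + l' x)\<^sup>2)
      = circint (\<lambda>x. (h x + b + l x)\<^sup>2 - (h' x + l' x)\<^sup>2)"
    by (simp add: circint_simps cont contl)
  also have "\<dots> = circint (\<lambda>x. ((h x)\<^sup>2 - (h' x)\<^sup>2 + 2 * b * h x + b\<^sup>2)
      - ((2 * h' x + l' x + 0) * l' x + (2 * h x + l x + 2 * b) * (- l x)))"
    by (intro integral_cong) (simp add: power2_eq_square algebra_simps)
  also have "\<dots> = circint (\<lambda>x. (h x)\<^sup>2 - (h' x)\<^sup>2 + 2 * b * h x + b\<^sup>2) - 0"
    by (subst circint_diff) (simp_all only: circint_derivative[OF G], (intro continuous_intros cont contl)+)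
  also have "\<dots> = circint (\<lambda>x. (h x)\<^sup>2) - circint (\<lambda>x. (h' x)\<^sup>2) + 2 * pi * b\<^sup>2"
    by (simp add: circint_simps cont m)
  finally show ?thesis unfolding l_def l'_def .
qed

text \<open>A function whose Fourier expansion starts with the second harmonic, together with its derivatives.\<close>
locale higher_harmonics =
  fixes h h1 h2 h3 :: "real \<Rightarrow> real"
  assumes C1: "C1_periodic h h1" "C1_periodic h1 h2" "C1_periodic h2 h3"
    and mean: "circint h = 0"
    and orth_cos: "circint (\<lambda>x. h x * cos x) = 0"
    and orth_sin: "circint (\<lambda>x. h x * sin x) = 0"
begin

text \<open>Up to the factor \<open>\<pi>\<close>, \<open>Ak\<close> is the sum of \<open>n\<^sup>2\<^sup>k (a\<^sub>n\<^sup>2 + b\<^sub>n\<^sup>2)\<close> over the Fourier coefficients of \<open>h\<close>.\<close>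
abbreviation "A0 \<equiv> circint (\<lambda>x. (h x)\<^sup>2)"
abbreviation "A1 \<equiv> circint (\<lambda>x. (h1 x)\<^sup>2)"
abbreviation "A2 \<equiv> circint (\<lambda>x. (h2 x)\<^sup>2)"
abbreviation "A3 \<equiv> circint (\<lambda>x. (h3 x)\<^sup>2)"

lemmas cont = C1_periodicD(3)[OF C1(1)] C1_periodicD(3)[OF C1(2)] C1_periodicD(2,3)[OF C1(3)]

lemma second_square: "circint (\<lambda>x. (h2 x + c * h x)\<^sup>2) = A2 - 2 * c * A1 + c\<^sup>2 * A0"
proof -
  have "circint (\<lambda>x. (h2 x + c * h x)\<^sup>2) = circint (\<lambda>x. (h2 x)\<^sup>2 + 2 * c * (h2 x * h x) + c\<^sup>2 * (h x)\<^sup>2)"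
    by (intro integral_cong) (simp add: power2_eq_square algebra_simps)
  also have "\<dots> = A2 + 2 * c * circint (\<lambda>x. h2 x * h x) + c\<^sup>2 * A0"
    by (simp add: circint_simps cont)
  also have "circint (\<lambda>x. h2 x * h x) = - A1"
    using circint_by_parts[OF C1(2,1)] by (simp add: power2_eq_square)
  finally show ?thesis by simp
qed

lemma third_square: "circint (\<lambda>x. (h3 x + c * h1 x)\<^sup>2) = A3 - 2 * c * A2 + c\<^sup>2 * A1"
proof -
  have "circint (\<lambda>x. (h3 x + c * h1 x)\<^sup>2) = circint (\<lambda>x. (h3 x)\<^sup>2 + 2 * c * (h3 x * h1 x) + c\<^sup>2 * (h1 x)\<^sup>2)"
    by (intro integral_cong) (simp add: power2_eq_square algebra_simps)
  also have "\<dots> = A3 + 2 * c * circint (\<lambda>x. h3 x * h1 x) + c\<^sup>2 * A1"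
    by (simp add: circint_simps cont)
  also have "circint (\<lambda>x. h3 x * h1 x) = - A2"
    using circint_by_parts[OF C1(3,2)] by (simp add: power2_eq_square)
  finally show ?thesis by simp
qed

lemma A0_nonneg: "0 \<le> A0"
  by (intro circint_nonneg continuous_intros cont) auto

lemma wirtinger: "4 * A0 \<le> A1"
  using wirtinger_second[OF C1(1) mean orth_cos orth_sin] .

text \<open>This is \<open>(n\<^sup>2 - 1)(n\<^sup>2 - 4) = (n\<^sup>2 - 4)\<^sup>2 + 3 (n\<^sup>2 - 4)\<close>, with the square realised by \<open>h'' + 4 h\<close>.\<close>
lemma second_order: "0 \<le> A2 - 5 * A1 + 4 * A0"
proof -
  have "0 \<le> circint (\<lambda>x. (h2 x + 4 * h x)\<^sup>2)"
    by (intro circint_nonneg continuous_intros cont) auto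
  thus ?thesis using second_square[of 4] wirtinger by simp
qed

text \<open>This is \<open>(n\<^sup>2 - 1)(n\<^sup>4 - 16) = n\<^sup>2 (n\<^sup>2 - 4)\<^sup>2 + 7 (n\<^sup>2 - 4)\<^sup>2 + 24 (n\<^sup>2 - 4)\<close>.\<close>
lemma third_order: "0 \<le> A3 - A2 - 16 * A1 + 16 * A0"
proof -
  have "0 \<le> circint (\<lambda>x. (h2 x + 4 * h x)\<^sup>2)" "0 \<le> circint (\<lambda>x. (h3 x + 4 * h1 x)\<^sup>2)"
    by (intro circint_nonneg continuous_intros cont; auto)+
  thus ?thesis using second_square[of 4] third_square[of 4] wirtinger by simp
qed

lemma A1_le_A2: "A1 \<le> A2"
  using second_order wirtinger A0_nonneg by linarith

text \<open>If \<open>A1 = 4 A0\<close>, then \<open>h\<close> minimises the nonnegative form \<open>\<integral>f'\<^sup>2 - 4 \<integral>f\<^sup>2\<close> among all functions without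
harmonics of order below two. The Euler equation of this problem is \<open>h'' + 4 h = 0\<close>; it follows by
varying \<open>h\<close> in the direction of \<open>g = h'' + 4 h\<close> itself.\<close>
lemma wirtinger_eq:
  assumes eq: "A1 = 4 * A0"
  shows "h2 x = - 4 * h x"
proof -
  define g where "g x = h2 x + 4 * h x" for x
  define g1 where "g1 x = h3 x + 4 * h1 x" for x
  have g: "C1_periodic g g1"
    unfolding g_def[abs_def] g1_def[abs_def] by (intro C1_periodic_intros C1)
  note contg = C1_periodicD(2,3)[OF g]
  have m: "circint g = 0"
    unfolding g_def using circint_derivative[OF C1(2)] by (simp add: circint_simps cont mean)
  have oc: "circint (\<lambda>x. h2 x * cos x) = 0"
    using circint_by_parts[OF C1(2) C1_periodic_cos] circint_by_parts[OF C1(1) C1_periodic_sin]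
      orth_cos by simp
  have os: "circint (\<lambda>x. h2 x * sin x) = 0"
    using circint_by_parts[OF C1(2) C1_periodic_sin] circint_by_parts[OF C1(1) C1_periodic_cos]
      orth_sin by simp
  have og: "circint (\<lambda>x. g x * cos x) = 0" "circint (\<lambda>x. g x * sin x) = 0"
    unfolding g_def using oc os orth_cos orth_sin
    by (simp_all add: distrib_right mult.assoc circint_simps cont)
  define G0 where "G0 = circint (\<lambda>x. (g x)\<^sup>2)"
  define G1 where "G1 = circint (\<lambda>x. (g1 x)\<^sup>2)"
  have parts: "circint (\<lambda>x. h1 x * g1 x) = - circint (\<lambda>x. h2 x * g x)"
    using circint_by_parts[OF C1(2) g] by simp
  have G0: "G0 = circint (\<lambda>x. h2 x * g x) + 4 * circint (\<lambda>x. h x * g x)"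
  proof -
    have "G0 = circint (\<lambda>x. h2 x * g x + 4 * (h x * g x))"
      unfolding G0_def by (intro integral_cong) (simp add: g_def power2_eq_square algebra_simps)
    thus ?thesis by (simp add: circint_simps cont contg)
  qed
  have var: "0 \<le> - 2 * t * G0 + t\<^sup>2 * (G1 - 4 * G0)" for t
  proof -
    have "4 * circint (\<lambda>x. (h x + t * g x)\<^sup>2) \<le> circint (\<lambda>x. (h1 x + t * g1 x)\<^sup>2)"
      using og orth_cos orth_sin
      by (intro wirtinger_second C1_periodic_intros C1 g)
        (simp_all add: distrib_right mult.assoc circint_simps cont contg mean m)
    also have "circint (\<lambda>x. (h1 x + t * g1 x)\<^sup>2) = circint (\<lambda>x. (h1 x)\<^sup>2 + 2 * t * (h1 x * g1 x) + t\<^sup>2 * (g1 x)\<^sup>2)"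
      by (intro integral_cong) (simp add: power2_eq_square algebra_simps)
    also have "circint (\<lambda>x. (h x + t * g x)\<^sup>2) = circint (\<lambda>x. (h x)\<^sup>2 + 2 * t * (h x * g x) + t\<^sup>2 * (g x)\<^sup>2)"
      by (intro integral_cong) (simp add: power2_eq_square algebra_simps)
    finally have "4 * (A0 + 2 * t * circint (\<lambda>x. h x * g x) + t\<^sup>2 * G0)
        \<le> A1 + 2 * t * circint (\<lambda>x. h1 x * g1 x) + t\<^sup>2 * G1"
      by (simp add: circint_simps cont contg G0_def G1_def)
    thus ?thesis unfolding parts eq using G0 by (simp add: algebra_simps)
  qed
  have "G0 \<le> 0"
  proof (rule ccontr)
    assume "\<not> G0 \<le> 0"
    hence p: "G0 > 0" by simp
    \<comment> \<open>A step of length \<open>G0 / N\<close> is short enough for the linear term in the variation to win.\<close>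
    define N where "N = \<bar>G1 - 4 * G0\<bar> + 1"
    have N: "N > 0" "G1 - 4 * G0 \<le> N" unfolding N_def by linarith+
    have "0 \<le> - 2 * (G0 / N) * G0 + (G0 / N)\<^sup>2 * (G1 - 4 * G0)" by (rule var)
    also have "\<dots> \<le> - 2 * (G0 / N) * G0 + (G0 / N)\<^sup>2 * N"
      using N by (intro add_left_mono mult_left_mono) auto
    also have "\<dots> = - (G0\<^sup>2 / N)"
      using N by (simp add: power2_eq_square)
    also have "\<dots> < 0" using p N by simp
    finally show False by simp
  qed
  moreover have "G0 \<ge> 0"
    unfolding G0_def by (intro circint_nonneg continuous_intros contg) auto
  ultimately have "circint (\<lambda>x. (g x)\<^sup>2) = 0" by (simp add: G0_def)
  hence "(g x)\<^sup>2 = 0"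
    by (intro circint_eq_0D[where f="\<lambda>x. (g x)\<^sup>2"] continuous_intros contg)
      (auto simp: C1_periodicD(4)[OF g])
  thus ?thesis by (simp add: g_def)
qed

text \<open>For the oscillator \<open>h'' = - 4 h\<close> the energy \<open>h\<^sup>2 + h'\<^sup>2 / 4\<close> is constant; its square root \<open>B\<close> is the amplitude.\<close>
lemma wirtinger_eq_amplitude:
  assumes eq: "A1 = 4 * A0"
  obtains B where "0 \<le> B" "\<And>x. \<bar>h x\<bar> \<le> B" "A0 = pi * B\<^sup>2"
proof -
  define E where "E x = (h x)\<^sup>2 + (h1 x)\<^sup>2 / 4" for x
  have "(E has_real_derivative 2 * h x * h1 x + 2 * h1 x * h2 x / 4) (at x)" for x
    unfolding E_def using C1_periodicD(1)[OF C1(1)] C1_periodicD(1)[OF C1(2)]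
    by (auto intro!: derivative_eq_intros)
  hence "\<forall>x. (E has_real_derivative 0) (at x)"
    using wirtinger_eq[OF eq] by simp
  hence const: "E x = E 0" for x by (rule DERIV_isconst_all)
  define B where "B = sqrt (E 0)"
  have B: "B \<ge> 0" "B\<^sup>2 = E 0" by (auto simp: B_def E_def)
  have "\<bar>h x\<bar> \<le> B" for x
  proof -
    have "(h x)\<^sup>2 \<le> E x" by (simp add: E_def)
    hence "\<bar>h x\<bar>\<^sup>2 \<le> B\<^sup>2" using const[of x] B by simp
    thus ?thesis using B(1) by (rule power2_le_imp_le)
  qed
  moreover have "A0 = pi * B\<^sup>2"
  proof -
    have "A0 + A1 / 4 = circint E"
      unfolding E_def by (simp add: circint_simps cont)
    also have "E = (\<lambda>x. B\<^sup>2)"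
      using const B by metis
    finally show ?thesis using eq by simp
  qed
  ultimately show ?thesis using that B by blast
qed

end

section \<open>Support functions and extremal disks\<close>

lemma normal_dir_nth [simp]: "normal_dir \<theta> $ 1 = cos \<theta>" "normal_dir \<theta> $ 2 = sin \<theta>"
  by (simp_all add: normal_dir_def)

lemma inner_normal_dir: "x \<bullet> normal_dir \<theta> = x $ 1 * cos \<theta> + x $ 2 * sin \<theta>"
  by (simp add: inner_vec_def sum_2)

lemma norm_normal_dir [simp]: "norm (normal_dir \<theta>) = 1"
  by (simp add: norm_eq_sqrt_inner inner_normal_dir flip: power2_eq_square)

lemma normal_dir_periodic [simp]: "normal_dir (\<theta> + 2 * pi) = normal_dir \<theta>"
  by (simp add: normal_dir_def)

lemma normal_dir_polar:
  fixes v :: "real^2"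
  obtains \<theta> where "v = norm v *\<^sub>R normal_dir \<theta>"
proof (cases "v = 0")
  case True thus ?thesis using that by simp
next
  case False
  have "(norm v)\<^sup>2 = (v $ 1)\<^sup>2 + (v $ 2)\<^sup>2"
    unfolding power2_norm_eq_inner by (simp add: inner_vec_def sum_2 power2_eq_square)
  moreover have "(v $ 1 / norm v)\<^sup>2 + (v $ 2 / norm v)\<^sup>2 = ((v $ 1)\<^sup>2 + (v $ 2)\<^sup>2) / (norm v)\<^sup>2"
    by (simp only: power_divide add_divide_distrib)
  ultimately have "(v $ 1 / norm v)\<^sup>2 + (v $ 2 / norm v)\<^sup>2 = (norm v)\<^sup>2 / (norm v)\<^sup>2"
    by (simp only:)
  also have "\<dots> = 1" using False by simp
  finally have "(v $ 1 / norm v)\<^sup>2 + (v $ 2 / norm v)\<^sup>2 = 1" .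
  then obtain \<theta> where \<theta>: "v $ 1 / norm v = cos \<theta>" "v $ 2 / norm v = sin \<theta>"
    by (rule sincos_total_2pi)
  have "v = norm v *\<^sub>R normal_dir \<theta>"
    using False by (simp add: vec_eq_iff forall_2 \<theta>[symmetric])
  thus ?thesis by (rule that)
qed

lemma inner_normal_dir_eq_norm:
  fixes v :: "real^2"
  obtains \<theta> where "v \<bullet> normal_dir \<theta> = norm v"
proof -
  obtain \<theta> where v: "v = norm v *\<^sub>R normal_dir \<theta>" by (rule normal_dir_polar)
  have "v \<bullet> normal_dir \<theta> = norm v * (normal_dir \<theta> \<bullet> normal_dir \<theta>)"
    by (subst v) simp
  also have "\<dots> = norm v" by (simp add: norm_eq_1[THEN iffD1])
  finally show ?thesis by (rule that)
qed

lemma inner_normal_dir_le_norm: "v \<bullet> normal_dir \<theta> \<le> norm v"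
  using norm_cauchy_schwarz[of v "normal_dir \<theta>"] by simp

lemma support_fun_ge:
  assumes "compact K" "x \<in> K"
  shows "x \<bullet> normal_dir \<theta> \<le> support_fun K \<theta>"
proof -
  have "compact ((\<lambda>x. x \<bullet> normal_dir \<theta>) ` K)"
    using assms by (intro compact_continuous_image continuous_intros)
  thus ?thesis unfolding support_fun_def
    using assms by (intro cSUP_upper bounded_imp_bdd_above compact_imp_bounded)
qed

lemma support_fun_le:
  assumes "K \<noteq> {}" "\<And>x. x \<in> K \<Longrightarrow> x \<bullet> normal_dir \<theta> \<le> b"
  shows "support_fun K \<theta> \<le> b"
  unfolding support_fun_def using assms by (intro cSUP_least)

lemma support_fun_cball:
  assumes "0 \<le> r"
  shows "support_fun (cball x r) \<theta> = x \<bullet> normal_dir \<theta> + r"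
proof (rule antisym)
  show "support_fun (cball x r) \<theta> \<le> x \<bullet> normal_dir \<theta> + r"
  proof (rule support_fun_le)
    fix y assume "y \<in> cball x r"
    hence "norm (y - x) \<le> r" by (simp add: dist_norm norm_minus_commute)
    hence "(y - x) \<bullet> normal_dir \<theta> \<le> r" using inner_normal_dir_le_norm order_trans by blast
    thus "y \<bullet> normal_dir \<theta> \<le> x \<bullet> normal_dir \<theta> + r" by (simp add: inner_diff_left)
  qed (use assms in auto)
  have "x + r *\<^sub>R normal_dir \<theta> \<in> cball x r"
    using assms by (simp add: dist_norm)
  from support_fun_ge[OF compact_cball this, of \<theta>]
  show "x \<bullet> normal_dir \<theta> + r \<le> support_fun (cball x r) \<theta>"
    by (simp add: inner_add_left norm_eq_1[THEN iffD1])
qed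

text \<open>A point outside a compact convex set is separated from it by a line, whose unit normal is some
\<open>normal_dir \<theta>\<close>.\<close>
lemma in_iff_support_fun:
  assumes "compact K" "convex K" "K \<noteq> {}"
  shows "x \<in> K \<longleftrightarrow> (\<forall>\<theta>. x \<bullet> normal_dir \<theta> \<le> support_fun K \<theta>)"
proof
  assume "x \<in> K" thus "\<forall>\<theta>. x \<bullet> normal_dir \<theta> \<le> support_fun K \<theta>"
    using support_fun_ge[OF assms(1)] by blast
next
  assume *: "\<forall>\<theta>. x \<bullet> normal_dir \<theta> \<le> support_fun K \<theta>"
  show "x \<in> K"
  proof (rule ccontr)
    assume "x \<notin> K"
    then obtain a b where ab: "a \<bullet> x < b" "\<And>y. y \<in> K \<Longrightarrow> a \<bullet> y > b"
      using separating_hyperplane_closed_point[of K x] assms compact_imp_closed by blast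
    obtain \<theta> where th: "- a = norm (- a) *\<^sub>R normal_dir \<theta>" by (rule normal_dir_polar)
    have "a \<noteq> 0" using ab assms(3) by auto
    hence na: "norm a > 0" by simp
    have in': "y \<bullet> normal_dir \<theta> = - (a \<bullet> y) / norm a" for y
    proof -
      have "- (a \<bullet> y) = norm a * (y \<bullet> normal_dir \<theta>)"
        using arg_cong[OF th, of "\<lambda>v. v \<bullet> y"] by (simp add: inner_commute)
      thus ?thesis using na by (simp add: field_simps)
    qed
    have "support_fun K \<theta> \<le> - b / norm a"
      using ab(2) na by (intro support_fun_le assms) (fastforce simp: in' divide_le_cancel)
    also have "\<dots> < x \<bullet> normal_dir \<theta>"
      using ab(1) na by (simp add: in' divide_less_cancel)
    finally show False using * by (meson not_le)
  qed
qed

lemma cball_subset_iff_support_fun: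
  assumes "compact K" "convex K" "K \<noteq> {}" "0 \<le> r"
  shows "cball x r \<subseteq> K \<longleftrightarrow> (\<forall>\<theta>. x \<bullet> normal_dir \<theta> + r \<le> support_fun K \<theta>)"
proof
  assume s: "cball x r \<subseteq> K"
  show "\<forall>\<theta>. x \<bullet> normal_dir \<theta> + r \<le> support_fun K \<theta>"
    using s assms unfolding support_fun_cball[OF assms(4), symmetric]
    by (auto intro!: support_fun_le support_fun_ge)
next
  assume *: "\<forall>\<theta>. x \<bullet> normal_dir \<theta> + r \<le> support_fun K \<theta>"
  show "cball x r \<subseteq> K"
  proof
    fix y assume "y \<in> cball x r"
    hence "y \<bullet> normal_dir \<theta> \<le> x \<bullet> normal_dir \<theta> + r" for \<theta>
      using support_fun_ge[OF compact_cball] support_fun_cball[OF assms(4)] by metis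
    thus "y \<in> K" using * in_iff_support_fun[OF assms(1-3)] order_trans by blast
  qed
qed

lemma subset_cball_iff_support_fun:
  assumes "compact K" "K \<noteq> {}" "0 \<le> r"
  shows "K \<subseteq> cball x r \<longleftrightarrow> (\<forall>\<theta>. support_fun K \<theta> \<le> x \<bullet> normal_dir \<theta> + r)"
proof
  assume s: "K \<subseteq> cball x r"
  show "\<forall>\<theta>. support_fun K \<theta> \<le> x \<bullet> normal_dir \<theta> + r"
    using s assms unfolding support_fun_cball[OF assms(3), symmetric]
    by (auto intro!: support_fun_le support_fun_ge)
next
  assume *: "\<forall>\<theta>. support_fun K \<theta> \<le> x \<bullet> normal_dir \<theta> + r"
  show "K \<subseteq> cball x r"
  proof
    fix y assume "y \<in> K"
    hence "\<forall>\<theta>. y \<bullet> normal_dir \<theta> \<le> support_fun (cball x r) \<theta>"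
      using support_fun_ge[OF assms(1)] * order_trans unfolding support_fun_cball[OF assms(3)] by blast
    thus "y \<in> cball x r"
      using in_iff_support_fun[OF compact_cball convex_cball, of x r y] assms(3) by simp
  qed
qed

text \<open>The smallest \<open>R\<close> for which \<open>p\<close> stays below \<open>x \<bullet> normal_dir \<theta> + R\<close> for some centre \<open>x\<close>, which is the
support function of a disk if \<open>R \<ge> 0\<close>. For \<open>p = support_fun K\<close> this is the circumradius. For
\<open>p = - support_fun K\<close> it is the negative of the inradius, with centre \<open>- x\<close>, so that both extremal
disks are handled by one argument.\<close>
definition least_offset :: "(real \<Rightarrow> real) \<Rightarrow> real^2 \<Rightarrow> real \<Rightarrow> bool" where
  "least_offset p x R \<longleftrightarrow> (\<forall>\<theta>. p \<theta> - x \<bullet> normal_dir \<theta> \<le> R)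
     \<and> (\<forall>y r. (\<forall>\<theta>. p \<theta> - y \<bullet> normal_dir \<theta> \<le> r) \<longrightarrow> R \<le> r)"

text \<open>The constraints define a closed set of pairs \<open>(x, R)\<close>. It suffices to look at \<open>R \<le> sup |p|\<close>, and
the constraint in the direction opposite to \<open>x\<close> then bounds \<open>x\<close>.\<close>
lemma least_offset_exists:
  assumes c: "continuous_on UNIV p" and per: "\<And>\<theta>. p (\<theta> + 2 * pi) = p \<theta>"
  obtains x R where "least_offset p x R"
proof -
  have "bounded (p ` {0..0 + 2 * pi})"
    by (intro compact_imp_bounded compact_continuous_image continuous_on_subset[OF c]) auto
  then obtain P where P: "\<forall>\<theta>\<in>{0..0 + 2 * pi}. \<bar>p \<theta>\<bar> \<le> P"
    unfolding bounded_iff by auto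
  have P: "\<bar>p \<theta>\<bar> \<le> P" for \<theta>
    using periodic_reduce[of p "2 * pi" 0 \<theta>] per P pi_gt_zero
    by (metis atLeastAtMost_iff zero_less_mult_iff zero_less_numeral)
  define S where "S = {z :: (real^2) \<times> real. \<forall>\<theta>. p \<theta> - fst z \<bullet> normal_dir \<theta> \<le> snd z} \<inter> {z. snd z \<le> P}"
  have "S \<subseteq> cball 0 (2 * P) \<times> {- P..P}"
  proof
    fix z assume z: "z \<in> S"
    obtain \<theta> where th: "(- fst z) \<bullet> normal_dir \<theta> = norm (- fst z)"
      by (rule inner_normal_dir_eq_norm)
    have "p \<theta> + norm (fst z) \<le> snd z" "snd z \<le> P"
      using z th unfolding S_def by (auto simp: algebra_simps dest!: spec[of _ \<theta>])
    hence "norm (fst z) \<le> 2 * P" "- P \<le> snd z" "snd z \<le> P"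
      using P[of \<theta>] norm_ge_zero[of "fst z"] by linarith+
    thus "z \<in> cball 0 (2 * P) \<times> {- P..P}" by (cases z) auto
  qed
  hence "bounded S"
    using bounded_Times[OF bounded_cball bounded_closed_interval] bounded_subset by blast
  moreover have "closed S"
  proof -
    have "S = (\<Inter>\<theta>. {z. p \<theta> - fst z \<bullet> normal_dir \<theta> \<le> snd z}) \<inter> {z. snd z \<le> P}"
      by (auto simp: S_def)
    thus ?thesis
      by (simp only:) (intro closed_Int closed_INT ballI closed_Collect_le continuous_intros)
  qed
  ultimately have "compact S" by (simp add: compact_eq_bounded_closed)
  have "(0, P) \<in> S"
    using P by (auto simp: S_def abs_le_iff)
  hence ne: "S \<noteq> {}" by auto
  have "continuous_on S snd" by (intro continuous_intros)
  from continuous_attains_inf[OF \<open>compact S\<close> ne this]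
  obtain z where z: "z \<in> S" "\<And>w. w \<in> S \<Longrightarrow> snd z \<le> snd w" by blast
  have "snd z \<le> r" if "\<forall>\<theta>. p \<theta> - y \<bullet> normal_dir \<theta> \<le> r" for y r
  proof (cases "r \<le> P")
    case True thus ?thesis using that z(2)[of "(y, r)"] by (auto simp: S_def)
  next
    case False thus ?thesis using z(1) by (auto simp: S_def)
  qed
  hence "least_offset p (fst z) (snd z)"
    using z(1) unfolding least_offset_def S_def by auto
  thus ?thesis by (rule that)
qed

text \<open>If some closed half circle contained no contact direction, there would be room on it, and moving the
centre away from the middle of that half circle would lower the offset strictly in all remaining
directions. By compactness the maximal offset would decrease, against minimality.\<close>
lemma least_offset_contact:
  assumes c: "continuous_on UNIV p" and per: "\<And>\<theta>. p (\<theta> + 2 * pi) = p \<theta>"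
    and l: "least_offset p x R"
  shows "\<exists>\<theta>\<in>{a..a + pi}. p \<theta> - x \<bullet> normal_dir \<theta> = R"
proof (rule ccontr)
  assume no: "\<not> ?thesis"
  define f where "f \<theta> = p \<theta> - x \<bullet> normal_dir \<theta>" for \<theta>
  have cf: "continuous_on A f" for A
    unfolding f_def inner_normal_dir by (intro continuous_intros continuous_on_subset[OF c]) auto
  have fR: "f \<theta> \<le> R" for \<theta> using l by (auto simp: least_offset_def f_def)
  have fa: "f \<theta> < R" if "\<theta> \<in> {a..a + pi}" for \<theta>
    using no that fR[of \<theta>] unfolding f_def by force
  have "{a..a + pi} \<noteq> {}" by simp
  then obtain t where t: "t \<in> {a..a + pi}" "\<And>\<theta>. \<theta> \<in> {a..a + pi} \<Longrightarrow> f \<theta> \<le> f t"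
    using continuous_attains_sup[OF compact_Icc _ cf] by blast
  \<comment> \<open>Half of the room left on the half circle: the shift by \<open>e\<close> cannot use it up.\<close>
  define e where "e = (R - f t) / 2"
  have e: "e > 0" "f t + e < R" using fa[OF t(1)] by (auto simp: e_def field_simps)
  define y where "y = x - e *\<^sub>R normal_dir (a + pi / 2)"
  define g where "g \<theta> = p \<theta> - y \<bullet> normal_dir \<theta>" for \<theta>
  have g: "g \<theta> = f \<theta> + e * sin (\<theta> - a)" for \<theta>
    unfolding g_def f_def y_def
    by (simp add: inner_diff_left inner_normal_dir cos_add sin_add sin_diff algebra_simps)
  have cg: "continuous_on A g" for A
    unfolding g by (intro continuous_intros cf)
  have gR: "g \<theta> < R" if "\<theta> \<in> {a..a + 2 * pi}" for \<theta>
  proof (cases "\<theta> \<le> a + pi")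
    case True
    have "e * sin (\<theta> - a) \<le> e * 1" using e by (intro mult_left_mono) auto
    moreover have "f \<theta> \<le> f t" using True that by (intro t(2)) auto
    ultimately show ?thesis using e(2) g[of \<theta>] by linarith
  next
    case False
    show ?thesis
    proof (cases "\<theta> = a + 2 * pi")
      case True
      have "f \<theta> = f a" unfolding True f_def by (simp add: per)
      thus ?thesis using fa[of a] True g[of \<theta>] by simp
    next
      case ne: False
      have "sin (\<theta> - a) < 0"
        using False ne that by (intro sin_lt_zero) auto
      hence "e * sin (\<theta> - a) < 0" using e by (simp add: mult_pos_neg)
      thus ?thesis using fR[of \<theta>] g[of \<theta>] by simp
    qed
  qed
  have "{a..a + 2 * pi} \<noteq> {}" by simp
  then obtain s where s: "s \<in> {a..a + 2 * pi}" "\<And>\<theta>. \<theta> \<in> {a..a + 2 * pi} \<Longrightarrow> g \<theta> \<le> g s"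
    using continuous_attains_sup[OF compact_Icc _ cg] by blast
  have "g (\<theta> + 2 * pi) = g \<theta>" for \<theta>
    by (simp add: g_def per)
  hence "\<forall>\<theta>. g \<theta> \<le> g s"
    using periodic_reduce[of g "2 * pi" a] s(2) pi_gt_zero
    by (metis atLeastAtMost_iff zero_less_mult_iff zero_less_numeral)
  hence "R \<le> g s" using l by (auto simp: least_offset_def g_def)
  thus False using gR[OF s(1)] by simp
qed

lemma circumradius_eq_least_offset:
  assumes "compact K" "K \<noteq> {}" "least_offset (support_fun K) x R"
  shows "circumradius K = R"
  unfolding circumradius_def
proof (rule cInf_eq_minimum)
  have le: "\<And>\<theta>. support_fun K \<theta> - x \<bullet> normal_dir \<theta> \<le> R"
    using assms(3) by (simp add: least_offset_def)
  obtain y where y: "y \<in> K" using assms(2) by auto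
  obtain \<theta> where "(y - x) \<bullet> normal_dir \<theta> = norm (y - x)" by (rule inner_normal_dir_eq_norm)
  hence "0 \<le> R"
    using le[of \<theta>] support_fun_ge[OF assms(1) y, of \<theta>] norm_ge_zero[of "y - x"]
    by (simp add: inner_diff_left del: norm_ge_zero)
  thus "R \<in> {r. 0 \<le> r \<and> (\<exists>x. K \<subseteq> cball x r)}"
    using le subset_cball_iff_support_fun[OF assms(1,2), of R x] by (auto simp: algebra_simps)
next
  fix r assume "r \<in> {r. 0 \<le> r \<and> (\<exists>x. K \<subseteq> cball x r)}"
  then obtain y where "0 \<le> r" "K \<subseteq> cball y r" by auto
  hence "\<forall>\<theta>. support_fun K \<theta> - y \<bullet> normal_dir \<theta> \<le> r"
    using subset_cball_iff_support_fun[OF assms(1,2)] by (auto simp: algebra_simps)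
  thus "R \<le> r" using assms(3) by (auto simp: least_offset_def)
qed

lemma inradius_eq_least_offset:
  assumes "compact K" "convex K" "K \<noteq> {}" "least_offset (\<lambda>\<theta>. - support_fun K \<theta>) x R"
  shows "inradius K = - R"
  unfolding inradius_def
proof (rule cSup_eq_maximum)
  have le: "\<And>\<theta>. - support_fun K \<theta> - x \<bullet> normal_dir \<theta> \<le> R"
    and min: "\<And>y r. \<forall>\<theta>. - support_fun K \<theta> - y \<bullet> normal_dir \<theta> \<le> r \<Longrightarrow> R \<le> r"
    using assms(4) by (auto simp: least_offset_def)
  obtain y where y: "y \<in> K" using assms(3) by auto
  have "R \<le> 0"
    using support_fun_ge[OF assms(1) y] by (intro min[of "- y"]) auto
  moreover have "\<forall>\<theta>. - x \<bullet> normal_dir \<theta> + - R \<le> support_fun K \<theta>"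
  proof
    fix \<theta> show "- x \<bullet> normal_dir \<theta> + - R \<le> support_fun K \<theta>" using le[of \<theta>] by simp
  qed
  ultimately show "- R \<in> {r. 0 \<le> r \<and> (\<exists>x. cball x r \<subseteq> K)}"
    using cball_subset_iff_support_fun[OF assms(1-3), of "- R" "- x"] by auto
  fix r assume "r \<in> {r. 0 \<le> r \<and> (\<exists>x. cball x r \<subseteq> K)}"
  then obtain y where "0 \<le> r" "cball y r \<subseteq> K" by auto
  hence "\<forall>\<theta>. y \<bullet> normal_dir \<theta> + r \<le> support_fun K \<theta>"
    using cball_subset_iff_support_fun[OF assms(1-3)] by blast
  hence "\<forall>\<theta>. - support_fun K \<theta> - (- y) \<bullet> normal_dir \<theta> \<le> - r"
    by (simp add: algebra_simps)
  from min[OF this] show "r \<le> - R" by simp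
qed

section \<open>Smoothness of the support function\<close>

lemma has_derivative_vec_nth_real:
  assumes "(c has_vector_derivative v) (at t)"
  shows "((\<lambda>s. c s $ i) has_real_derivative v $ i) (at t)"
  using bounded_linear.has_vector_derivative[OF bounded_linear_vec_nth assms]
  by (simp add: has_real_derivative_iff_has_vector_derivative)

text \<open>Two solutions of one linear scalar equation are proportional; this replaces an appeal to uniqueness
for ordinary differential equations.\<close>
lemma scaled_linear_ode_const:
  fixes y q s :: "real \<Rightarrow> real"
  assumes "\<And>t. (y has_real_derivative s t * y t) (at t)"
    and "\<And>t. (q has_real_derivative s t * q t) (at t)" and "\<And>t. q t \<noteq> 0"
  shows "y t / q t = y 0 / q 0"
proof -
  have "\<forall>t. ((\<lambda>t. y t / q t) has_real_derivative 0) (at t)"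
  proof
    fix t
    have "((\<lambda>t. y t / q t) has_real_derivative (s t * y t * q t - y t * (s t * q t)) / (q t * q t)) (at t)"
      using assms by (intro DERIV_divide)
    thus "((\<lambda>t. y t / q t) has_real_derivative 0) (at t)" by (simp add: algebra_simps)
  qed
  from DERIV_isconst_all[OF this] show ?thesis .
qed

text \<open>A continuous choice of the tangent angle. Let \<open>\<phi>\<close> be a primitive of the expected angular velocity with
the right initial value. The components \<open>S\<close> and \<open>H\<close> of \<open>v\<close> along the normal and the tangent direction
given by \<open>\<phi>\<close> satisfy the same linear equation as \<open>|v|\<close>, hence keep their initial ratios to \<open>|v|\<close>, which
are zero and one.\<close>
lemma tangent_angle_exists:
  fixes v1 v2 a1 a2 :: "real \<Rightarrow> real"
  assumes d: "\<And>t. (v1 has_real_derivative a1 t) (at t)" "\<And>t. (v2 has_real_derivative a2 t) (at t)"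
    and c: "continuous_on UNIV a1" "continuous_on UNIV a2"
    and nz: "\<And>t. (v1 t)\<^sup>2 + (v2 t)\<^sup>2 > 0"
  obtains \<phi> where
    "\<And>t. (\<phi> has_real_derivative (v1 t * a2 t - v2 t * a1 t) / ((v1 t)\<^sup>2 + (v2 t)\<^sup>2)) (at t)"
    "\<And>t. v1 t = - sqrt ((v1 t)\<^sup>2 + (v2 t)\<^sup>2) * sin (\<phi> t)"
    "\<And>t. v2 t = sqrt ((v1 t)\<^sup>2 + (v2 t)\<^sup>2) * cos (\<phi> t)"
proof -
  define q where "q t = (v1 t)\<^sup>2 + (v2 t)\<^sup>2" for t
  define w where "w t = (v1 t * a2 t - v2 t * a1 t) / q t" for t
  define s where "s t = (v1 t * a1 t + v2 t * a2 t) / q t" for t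
  have q: "q t > 0" for t using nz by (simp add: q_def)
  have q0: "q t \<noteq> 0" for t using q[of t] by simp
  have cv: "continuous_on UNIV v1" "continuous_on UNIV v2"
    using d by (meson DERIV_isCont continuous_at_imp_continuous_on)+
  have "continuous_on UNIV w"
    unfolding w_def using q0 unfolding q_def by (intro continuous_intros cv c) auto
  then obtain F where F: "\<And>t. (F has_real_derivative w t) (at t)"
    using continuous_has_antiderivative by blast
  have "(v2 0 / sqrt (q 0))\<^sup>2 + (- v1 0 / sqrt (q 0))\<^sup>2 = 1"
    using q[of 0] q0[of 0] by (simp add: power_divide flip: add_divide_distrib) (simp add: q_def add.commute)
  then obtain u where u: "v2 0 / sqrt (q 0) = cos u" "- v1 0 / sqrt (q 0) = sin u"
    by (rule sincos_total_2pi)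
  define \<phi> where "\<phi> t = F t + (u - F 0)" for t
  have d\<phi>: "(\<phi> has_real_derivative w t) (at t)" for t
    unfolding \<phi>_def using F by (auto intro!: derivative_eq_intros)
  have \<phi>0: "\<phi> 0 = u" by (simp add: \<phi>_def)
  define S where "S t = v1 t * cos (\<phi> t) + v2 t * sin (\<phi> t)" for t
  define H where "H t = v2 t * cos (\<phi> t) - v1 t * sin (\<phi> t)" for t
  have a: "a1 t = s t * v1 t - w t * v2 t" "a2 t = s t * v2 t + w t * v1 t" for t
  proof -
    have "s t * v1 t - w t * v2 t = a1 t * q t / q t"
      unfolding s_def w_def by (simp add: q_def power2_eq_square algebra_simps flip: diff_divide_distrib)
    thus "a1 t = s t * v1 t - w t * v2 t" using q0[of t] by simp
    have "s t * v2 t + w t * v1 t = a2 t * q t / q t"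
      unfolding s_def w_def by (simp add: q_def power2_eq_square algebra_simps flip: add_divide_distrib)
    thus "a2 t = s t * v2 t + w t * v1 t" using q0[of t] by simp
  qed
  have dS: "(S has_real_derivative s t * S t) (at t)" for t
    unfolding S_def
    by (rule derivative_eq_intros d d\<phi> refl)+ (simp add: a algebra_simps)
  have dH: "(H has_real_derivative s t * H t) (at t)" for t
    unfolding H_def
    by (rule derivative_eq_intros d d\<phi> refl)+ (simp add: a algebra_simps)
  have dq: "((\<lambda>t. sqrt (q t)) has_real_derivative s t * sqrt (q t)) (at t)" for t
  proof -
    have "(q has_real_derivative 2 * (v1 t * a1 t + v2 t * a2 t)) (at t)"
      unfolding q_def using d by (auto intro!: derivative_eq_intros simp: algebra_simps)
    hence "((\<lambda>t. sqrt (q t)) has_real_derivative inverse (sqrt (q t)) / 2 * (2 * (v1 t * a1 t + v2 t * a2 t))) (at t)"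
      by (rule DERIV_chain2[where f=sqrt and g=q, OF DERIV_real_sqrt[OF q[of t]]])
    moreover have inv: "inverse (sqrt (q t)) = sqrt (q t) / q t"
      using q[of t] by (simp add: inverse_eq_divide frac_eq_eq flip: real_sqrt_mult)
    have "x / y / 2 * (2 * z) = z / y * x" for x y z :: real
      by simp
    hence "inverse (sqrt (q t)) / 2 * (2 * (v1 t * a1 t + v2 t * a2 t)) = s t * sqrt (q t)"
      by (simp only: inv s_def)
    ultimately show ?thesis by simp
  qed
  have sq0: "sqrt (q t) \<noteq> 0" for t using q0[of t] by simp
  have S: "S t = 0" for t
  proof -
    have "S 0 = (v2 0 / sqrt (q 0) * sin u + v1 0 / sqrt (q 0) * cos u) * sqrt (q 0)"
      using sq0[of 0] unfolding S_def \<phi>0 by (simp add: field_simps)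
    also have "v1 0 / sqrt (q 0) = - sin u" using u(2) by simp
    finally have "S 0 = 0" using u(1) by simp
    thus ?thesis using scaled_linear_ode_const[OF dS dq sq0, of t] sq0[of t] by simp
  qed
  have H: "H t = sqrt (q t)" for t
  proof -
    have "H 0 = (v2 0 / sqrt (q 0) * cos u - v1 0 / sqrt (q 0) * sin u) * sqrt (q 0)"
      using sq0[of 0] unfolding H_def \<phi>0 by (simp add: field_simps)
    also have "v1 0 / sqrt (q 0) = - sin u" using u(2) by simp
    finally have "H 0 = sqrt (q 0)" using u(1) by (simp flip: power2_eq_square)
    thus ?thesis using scaled_linear_ode_const[OF dH dq sq0, of t] sq0[of t] sq0[of 0] by simp
  qed
  have v: "v1 t = - sqrt (q t) * sin (\<phi> t)" "v2 t = sqrt (q t) * cos (\<phi> t)" for t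
  proof -
    have "S t * cos (\<phi> t) - H t * sin (\<phi> t)
        = v1 t * (cos (\<phi> t) * cos (\<phi> t) + sin (\<phi> t) * sin (\<phi> t))"
      unfolding S_def H_def by (simp add: algebra_simps del: sin_cos_squared_add3)
    thus "v1 t = - sqrt (q t) * sin (\<phi> t)" by (simp add: S H)
    have "S t * sin (\<phi> t) + H t * cos (\<phi> t)
        = v2 t * (cos (\<phi> t) * cos (\<phi> t) + sin (\<phi> t) * sin (\<phi> t))"
      unfolding S_def H_def by (simp add: algebra_simps del: sin_cos_squared_add3)
    thus "v2 t = sqrt (q t) * cos (\<phi> t)" by (simp add: S H)
  qed
  show ?thesis
    by (rule that[OF d\<phi>[unfolded w_def q_def] v[unfolded q_def]])
qed

lemma second_derivative_at_max:
  fixes g g' :: "real \<Rightarrow> real"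
  assumes d: "\<And>s. (g has_real_derivative g' s) (at s)" and d2: "(g' has_real_derivative k) (at t)"
    and max: "\<And>s. g s \<le> g t"
  shows "g' t = 0" "k \<le> 0"
proof -
  show 0: "g' t = 0"
    using DERIV_local_max[OF d, of 1 t] max by simp
  show "k \<le> 0"
  proof (rule ccontr)
    assume "\<not> k \<le> 0"
    then obtain e where e: "e > 0" "\<And>h. 0 < h \<Longrightarrow> h < e \<Longrightarrow> g' t < g' (t + h)"
      using DERIV_pos_inc_right[OF d2] by auto
    obtain z where z: "t < z" "z < t + e / 2" "g (t + e / 2) - g t = (t + e / 2 - t) * g' z"
      using MVT2[of t "t + e / 2" g g'] d e(1) by auto
    have "g' z > 0" using e(2)[of "z - t"] z 0 e(1) by auto
    hence "g (t + e / 2) > g t" using z(3) e(1)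
      by (metis add.commute add_diff_cancel_left' diff_gt_0_iff_gt half_gt_zero mult_pos_pos)
    thus False using max[of "t + e / 2"] by simp
  qed
qed

text \<open>Periodicity of \<open>w\<close> makes \<open>\<phi>\<close> grow by the same positive amount over every period, so \<open>\<phi>\<close> is onto.\<close>
lemma increasing_inverse_exists:
  fixes \<phi> w :: "real \<Rightarrow> real"
  assumes d: "\<And>t. (\<phi> has_real_derivative w t) (at t)" and w: "\<And>t. w t > 0"
    and per: "\<And>t. w (t + T) = w t" and T: "T > 0"
  obtains \<psi> where "\<And>\<theta>. \<phi> (\<psi> \<theta>) = \<theta>" "\<And>\<theta>. (\<psi> has_real_derivative inverse (w (\<psi> \<theta>))) (at \<theta>)"
proof -
  have mono: "\<phi> s < \<phi> t" if "s < t" for s t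
    using that d w by (intro DERIV_pos_imp_increasing[of s t \<phi>]) blast+
  have inj: "\<phi> s = \<phi> t \<Longrightarrow> s = t" for s t
    using mono[of s t] mono[of t s] by (cases s t rule: linorder_cases) auto
  have cont: "isCont \<phi> t" for t using d by (rule DERIV_isCont)
  define D where "D = \<phi> T - \<phi> 0"
  have D: "D > 0" using mono[OF T] by (simp add: D_def)
  have "\<forall>t. ((\<lambda>t. \<phi> (t + T) - \<phi> t) has_real_derivative 0) (at t)"
  proof
    fix t
    have "((\<lambda>t. \<phi> (t + T)) has_real_derivative w (t + T)) (at t)"
      using DERIV_shift[of \<phi>] d by blast
    from DERIV_diff[OF this d[of t]] show "((\<lambda>t. \<phi> (t + T) - \<phi> t) has_real_derivative 0) (at t)"
      by (simp add: per)
  qed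
  from DERIV_isconst_all[OF this, of _ 0] have step: "\<phi> (t + T) = \<phi> t + D" for t
    unfolding D_def by (metis add.commute add_0 diff_add_cancel diff_add_eq)
  have up: "\<phi> (of_nat n * T) = \<phi> 0 + of_nat n * D" for n
  proof (induction n)
    case (Suc n)
    thus ?case using step[of "of_nat n * T"] by (simp add: algebra_simps)
  qed simp
  have down: "\<phi> (- (of_nat n * T)) = \<phi> 0 - of_nat n * D" for n
  proof (induction n)
    case (Suc n)
    thus ?case using step[of "- (of_nat (Suc n) * T)"] by (simp add: algebra_simps)
  qed simp
  have "\<exists>t. \<phi> t = \<theta>" for \<theta>
  proof -
    obtain n :: nat where n: "\<bar>\<theta> - \<phi> 0\<bar> / D < of_nat n" using reals_Archimedean2 by blast
    hence "\<bar>\<theta> - \<phi> 0\<bar> < of_nat n * D" using D by (simp add: field_simps)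
    hence "\<phi> (- (of_nat n * T)) \<le> \<theta>" "\<theta> \<le> \<phi> (of_nat n * T)"
      unfolding up down by linarith+
    moreover have "- (of_nat n * T) \<le> of_nat n * T" using T by simp
    ultimately show ?thesis
      using IVT[of \<phi> "- (of_nat n * T)" \<theta> "of_nat n * T"] cont by blast
  qed
  then obtain \<psi> where \<psi>: "\<And>\<theta>. \<phi> (\<psi> \<theta>) = \<theta>" by metis
  have inv: "\<psi> (\<phi> t) = t" for t using inj \<psi> by blast
  have "isCont \<psi> \<theta>" for \<theta>
    using isCont_inverse_function[of 1 "\<psi> \<theta>" \<psi> \<phi>] inv cont \<psi> by simp
  hence "(\<psi> has_real_derivative inverse (w (\<psi> \<theta>))) (at \<theta>)" for \<theta>
    using w[of "\<psi> \<theta>"] \<psi> by (intro DERIV_inverse_function[OF d, of \<psi> \<theta> "\<theta> - 1" "\<theta> + 1"]) auto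
  thus ?thesis using that \<psi> by blast
qed

text \<open>Let \<open>\<phi> t\<close> be the angle of the right normal of the curve \<open>c\<close> at \<open>t\<close>; since the curvature is positive,
\<open>\<phi>\<close> has an inverse \<open>\<psi>\<close>. At every boundary point \<open>c t\<close> there is a supporting line of the convex set \<open>K\<close>. The first
derivative test makes its normal parallel to \<open>normal_dir (\<phi> t)\<close>, and the second one, with positive
curvature, fixes the sign. Hence \<open>p \<theta> = c (\<psi> \<theta>) \<bullet> normal_dir \<theta>\<close>. Differentiating, \<open>p'' + p\<close> is the
curvature radius \<open>r = |v| / w\<close> at \<open>\<psi> \<theta>\<close>, which is positive and has one more continuous derivative.\<close>
lemma smooth_support_fun:
  assumes K: "strictly_convex_domain K" "bounded_by_smooth_pos_curved_curve K"
  obtains p1 p2 p3 where "C1_periodic (support_fun K) p1" "C1_periodic p1 p2" "C1_periodic p2 p3"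
    "\<And>\<theta>. 0 < support_fun K \<theta> + p2 \<theta>"
proof -
  obtain c T where T: "T > 0" and smooth: "smooth_curve c" and per: "\<And>t. c (t + T) = c t"
    and nz: "\<And>t. vector_derivative c (at t) \<noteq> 0" and curv: "\<And>t. signed_curvature c t > 0"
    and fr: "frontier K = c ` {0..T}"
    using K(2) unfolding bounded_by_smooth_pos_curved_curve_def by blast
  have cK: "compact K" "convex K" "interior K \<noteq> {}"
    using K(1) by (auto simp: strictly_convex_domain_def)
  have ne: "K \<noteq> {}" using cK(3) by auto
  define v where "v t = vector_derivative c (at t)" for t
  define a where "a t = vector_derivative v (at t)" for t
  define b where "b t = vector_derivative a (at t)" for t
  have diff: "c differentiable (at t)" "v differentiable (at t)" "a differentiable (at t)"
    "b differentiable (at t)" for t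
  proof -
    define F where "F = (\<lambda>f::real\<Rightarrow>real^2. \<lambda>s. vector_derivative f (at s))"
    have s: "(F ^^ n) c differentiable (at t)" for n
      using smooth unfolding smooth_curve_def F_def by blast
    have F: "F c = v" "F v = a" "F a = b"
      by (auto simp: F_def v_def a_def b_def fun_eq_iff)
    show "c differentiable (at t)" "v differentiable (at t)" "a differentiable (at t)"
      "b differentiable (at t)"
      using s[of 0] s[of "Suc 0"] s[of "Suc (Suc 0)"] s[of "Suc (Suc (Suc 0))"] by (simp_all add: F)
  qed
  have dc: "((\<lambda>s. c s $ i) has_real_derivative v t $ i) (at t)"
    and dv: "((\<lambda>s. v s $ i) has_real_derivative a t $ i) (at t)"
    and da: "((\<lambda>s. a s $ i) has_real_derivative b t $ i) (at t)" for t i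
    using diff[of t] unfolding v_def a_def b_def
    by (auto intro!: has_derivative_vec_nth_real simp: vector_derivative_works)
  have cc: "continuous_on A (\<lambda>s. c s $ i)" "continuous_on A (\<lambda>s. v s $ i)"
    "continuous_on A (\<lambda>s. a s $ i)" for A i
    using dc dv da by (meson DERIV_isCont continuous_at_imp_continuous_on)+
  have cb: "continuous_on A (\<lambda>s. b s $ i)" for A i
    using diff(4)
    by (intro bounded_linear.continuous_on[OF bounded_linear_vec_nth] continuous_at_imp_continuous_on
        ballI differentiable_imp_continuous_within)
  have per_v: "v (t + T) = v t" for t
  proof -
    have "v (t + T) $ i = v t $ i" for i
    proof -
      have "((\<lambda>s. c (s + T) $ i) has_real_derivative v (t + T) $ i) (at t)"
        using dc[of i "t + T"] by (simp only: DERIV_shift[of "\<lambda>s. c s $ i"])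
      thus ?thesis using DERIV_unique[OF dc] by (simp add: per)
    qed
    thus ?thesis by (simp add: vec_eq_iff)
  qed
  have per_a: "a (t + T) = a t" for t
  proof -
    have "a (t + T) $ i = a t $ i" for i
    proof -
      have "((\<lambda>s. v (s + T) $ i) has_real_derivative a (t + T) $ i) (at t)"
        using dv[of i "t + T"] by (simp only: DERIV_shift[of "\<lambda>s. v s $ i"])
      thus ?thesis using DERIV_unique[OF dv] by (simp add: per_v)
    qed
    thus ?thesis by (simp add: vec_eq_iff)
  qed
  define q where "q t = (v t $ 1)\<^sup>2 + (v t $ 2)\<^sup>2" for t
  define k where "k t = v t $ 1 * a t $ 2 - v t $ 2 * a t $ 1" for t
  have q: "q t > 0" for t
    using nz[of t] unfolding q_def v_def[symmetric] by (auto simp: vec_eq_iff forall_2 sum_power2_gt_zero_iff)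
  have k: "k t > 0" for t
    using curv[of t] unfolding signed_curvature_def v_def[symmetric] a_def[symmetric] k_def
    by (auto simp: Let_def zero_less_divide_iff zero_less_power_eq dest: order.strict_trans1[OF norm_ge_zero])
  obtain \<phi> where d\<phi>: "\<And>t. (\<phi> has_real_derivative k t / q t) (at t)"
    and v1: "\<And>t. v t $ 1 = - sqrt (q t) * sin (\<phi> t)" and v2: "\<And>t. v t $ 2 = sqrt (q t) * cos (\<phi> t)"
    unfolding q_def k_def
    using tangent_angle_exists[OF dv dv cc(3) cc(3) q[unfolded q_def]] by blast
  define w where "w t = k t / q t" for t
  have w: "w t > 0" for t using q k by (simp add: w_def)
  obtain \<psi> where \<psi>: "\<And>\<theta>. \<phi> (\<psi> \<theta>) = \<theta>"
    and d\<psi>: "\<And>\<theta>. (\<psi> has_real_derivative inverse (w (\<psi> \<theta>))) (at \<theta>)"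
    by (rule increasing_inverse_exists[of \<phi> w T])
      (use d\<phi> w T in \<open>auto simp: w_def k_def q_def per_v per_a\<close>)
  have support: "support_fun K (\<phi> t) = c t \<bullet> normal_dir (\<phi> t)" for t
  proof -
    have c_fr: "c s \<in> frontier K" for s
    proof -
      obtain y where "0 \<le> y" "y \<le> 0 + T" "c s = c y"
        using periodic_reduce[of c T 0 s] per T by blast
      thus ?thesis unfolding fr by auto
    qed
    have cs: "c s \<in> K" for s
      using c_fr[of s] frontier_subset_closed[OF compact_imp_closed[OF cK(1)]] by blast
    have "c t \<notin> rel_interior K"
      using c_fr[of t] rel_interior_nonempty_interior[OF cK(3)] by (simp add: frontier_def)
    then obtain m0 where m0: "m0 \<noteq> 0" "\<And>y. y \<in> closure K \<Longrightarrow> m0 \<bullet> c t \<le> m0 \<bullet> y"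
      using supporting_hyperplane_relative_frontier[OF cK(2), of "c t"] cs[of t] closure_subset
      by (metis subsetD)
    define m where "m = - m0"
    have m: "m \<noteq> 0" "\<And>y. y \<in> K \<Longrightarrow> y \<bullet> m \<le> c t \<bullet> m"
      using m0 closure_subset unfolding m_def by (auto simp: inner_commute subset_iff)
    have g1: "((\<lambda>s. c s \<bullet> m) has_real_derivative v s $ 1 * m $ 1 + v s $ 2 * m $ 2) (at s)" for s
      unfolding inner_vec_def sum_2 inner_real_def
      by (intro DERIV_add DERIV_cmult_right dc)
    have g2: "((\<lambda>s. v s $ 1 * m $ 1 + v s $ 2 * m $ 2) has_real_derivative
        a t $ 1 * m $ 1 + a t $ 2 * m $ 2) (at t)"
      by (intro DERIV_add DERIV_cmult_right dv)
    have first: "v t $ 1 * m $ 1 + v t $ 2 * m $ 2 = 0"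
      and second: "a t $ 1 * m $ 1 + a t $ 2 * m $ 2 \<le> 0"
      by (rule second_derivative_at_max[OF g1 g2 m(2)[OF cs]])+
    \<comment> \<open>\<open>m\<close> is \<open>\<kappa>\<close> times the right normal of the curve; the sign of \<open>\<kappa>\<close> comes from the second derivative test.\<close>
    define \<kappa> where "\<kappa> = m $ 1 * cos (\<phi> t) + m $ 2 * sin (\<phi> t)"
    have "sqrt (q t) * (m $ 2 * cos (\<phi> t) - m $ 1 * sin (\<phi> t)) = 0"
      using first unfolding v1 v2 by (simp add: algebra_simps)
    hence perp: "m $ 2 * cos (\<phi> t) = m $ 1 * sin (\<phi> t)" using q[of t] by simp
    have m1: "m $ 1 = \<kappa> * cos (\<phi> t)"
    proof -
      have "\<kappa> * cos (\<phi> t) = m $ 1 * (cos (\<phi> t))\<^sup>2 + (m $ 2 * cos (\<phi> t)) * sin (\<phi> t)"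
        by (simp add: \<kappa>_def power2_eq_square algebra_simps)
      also have "\<dots> = m $ 1 * ((sin (\<phi> t))\<^sup>2 + (cos (\<phi> t))\<^sup>2)"
        unfolding perp by (simp only: power2_eq_square algebra_simps)
      finally show ?thesis by simp
    qed
    have m2: "m $ 2 = \<kappa> * sin (\<phi> t)"
    proof -
      have "\<kappa> * sin (\<phi> t) = (m $ 1 * sin (\<phi> t)) * cos (\<phi> t) + m $ 2 * (sin (\<phi> t))\<^sup>2"
        by (simp add: \<kappa>_def power2_eq_square algebra_simps)
      also have "\<dots> = m $ 2 * ((sin (\<phi> t))\<^sup>2 + (cos (\<phi> t))\<^sup>2)"
        unfolding perp[symmetric] by (simp only: power2_eq_square algebra_simps)
      finally show ?thesis by simp
    qed
    have inm: "y \<bullet> m = \<kappa> * (y \<bullet> normal_dir (\<phi> t))" for y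
      by (simp add: inner_vec_def sum_2 m1 m2 algebra_simps)
    have "\<kappa> \<noteq> 0" using m(1) m1 m2 by (auto simp: vec_eq_iff forall_2)
    moreover have "\<kappa> \<ge> 0"
    proof (rule ccontr)
      assume "\<not> \<kappa> \<ge> 0"
      moreover have "sqrt (q t) * (a t $ 1 * cos (\<phi> t) + a t $ 2 * sin (\<phi> t)) < 0"
        using k[of t] unfolding k_def v1 v2 by (simp add: algebra_simps)
      hence "a t $ 1 * cos (\<phi> t) + a t $ 2 * sin (\<phi> t) < 0"
        using q[of t] by (simp add: mult_less_0_iff)
      ultimately have "\<kappa> * (a t $ 1 * cos (\<phi> t) + a t $ 2 * sin (\<phi> t)) > 0"
        by (intro mult_neg_neg) auto
      thus False using second unfolding m1 m2 by (simp add: algebra_simps)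
    qed
    ultimately have "\<kappa> > 0" by simp
    hence "y \<bullet> normal_dir (\<phi> t) \<le> c t \<bullet> normal_dir (\<phi> t)" if "y \<in> K" for y
      using m(2)[OF that] unfolding inm by simp
    thus ?thesis
      by (intro antisym support_fun_le support_fun_ge cK ne cs)
  qed
  define p where "p = support_fun K"
  have p: "p \<theta> = c (\<psi> \<theta>) $ 1 * cos \<theta> + c (\<psi> \<theta>) $ 2 * sin \<theta>" for \<theta>
    using support[of "\<psi> \<theta>"] by (simp add: \<psi> inner_normal_dir p_def)
  define r where "r t = sqrt (q t) * q t / k t" for t
  define q' where "q' t = 2 * (v t $ 1 * a t $ 1 + v t $ 2 * a t $ 2)" for t
  define k' where "k' t = v t $ 1 * b t $ 2 - v t $ 2 * b t $ 1" for t
  define r' where "r' t = ((inverse (sqrt (q t)) / 2 * q' t * q t + sqrt (q t) * q' t) * k t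
     - sqrt (q t) * q t * k' t) / (k t * k t)" for t
  define p1 where "p1 \<theta> = c (\<psi> \<theta>) $ 2 * cos \<theta> - c (\<psi> \<theta>) $ 1 * sin \<theta>" for \<theta>
  define p2 where "p2 \<theta> = r (\<psi> \<theta>) - p \<theta>" for \<theta>
  define p3 where "p3 \<theta> = r' (\<psi> \<theta>) * inverse (w (\<psi> \<theta>)) - p1 \<theta>" for \<theta>
  have r: "r t > 0" "r t = sqrt (q t) * inverse (w t)" for t
    using q[of t] k[of t] by (simp_all add: r_def w_def)
  have dq: "(q has_real_derivative q' t) (at t)" for t
    unfolding q_def q'_def by (rule derivative_eq_intros dv refl)+ (simp add: algebra_simps)
  have dk: "(k has_real_derivative k' t) (at t)" for t
    unfolding k_def k'_def by (rule derivative_eq_intros dv da refl)+ (simp add: algebra_simps)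
  have dsq: "((\<lambda>t. sqrt (q t)) has_real_derivative inverse (sqrt (q t)) / 2 * q' t) (at t)" for t
    by (rule DERIV_chain2[where f=sqrt and g=q, OF DERIV_real_sqrt[OF q[of t]] dq])
  have dr: "(r has_real_derivative r' t) (at t)" for t
    unfolding r_def[abs_def] r'_def using k[of t]
    by (intro DERIV_divide[OF DERIV_mult'[OF dsq dq, THEN DERIV_cong] dk]) (auto simp: algebra_simps)
  have dcomp: "((\<lambda>\<theta>. f (\<psi> \<theta>)) has_real_derivative f' (\<psi> \<theta>) * inverse (w (\<psi> \<theta>))) (at \<theta>)"
    if "\<And>t. (f has_real_derivative f' t) (at t)" for f f' \<theta>
    by (rule DERIV_chain2[OF that d\<psi>])
  note dcx = dcomp[of "\<lambda>s. c s $ 1" "\<lambda>s. v s $ 1", OF dc]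
  note dcy = dcomp[of "\<lambda>s. c s $ 2" "\<lambda>s. v s $ 2", OF dc]
  have dp: "(p has_real_derivative p1 \<theta>) (at \<theta>)" for \<theta>
    unfolding p[abs_def] p1_def
    by (rule derivative_eq_intros dcx dcy refl)+ (simp add: v1 v2 \<psi> algebra_simps)
  have dp1: "(p1 has_real_derivative p2 \<theta>) (at \<theta>)" for \<theta>
  proof -
    have "(p1 has_real_derivative r (\<psi> \<theta>) * (sin \<theta> * sin \<theta>) + r (\<psi> \<theta>) * (cos \<theta> * cos \<theta>) - p \<theta>) (at \<theta>)"
      unfolding p1_def[abs_def]
      by (rule derivative_eq_intros dcx dcy refl)+ (simp add: v1 v2 \<psi> p r(2) algebra_simps)
    moreover have "r (\<psi> \<theta>) * (sin \<theta> * sin \<theta>) + r (\<psi> \<theta>) * (cos \<theta> * cos \<theta>) = r (\<psi> \<theta>)"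
      by (simp flip: distrib_left power2_eq_square)
    ultimately show ?thesis by (simp add: p2_def)
  qed
  have dp2: "(p2 has_real_derivative p3 \<theta>) (at \<theta>)" for \<theta>
    unfolding p2_def[abs_def] p3_def by (intro DERIV_diff dcomp dr dp)
  have cont_p1: "continuous_on UNIV p1" and cont_p2: "continuous_on UNIV p2"
    using dp1 dp2 by (meson DERIV_isCont continuous_at_imp_continuous_on)+
  have cont_\<psi>: "continuous_on UNIV \<psi>"
    using d\<psi> by (meson DERIV_isCont continuous_at_imp_continuous_on)
  have kq: "k t \<noteq> 0" "sqrt (q t) \<noteq> 0" "w t \<noteq> 0" "q t \<noteq> 0" for t
    using k[of t] q[of t] w[of t] by auto
  have cq: "continuous_on UNIV q" and ck: "continuous_on UNIV k"
    using dq dk by (meson DERIV_isCont continuous_at_imp_continuous_on)+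
  have "continuous_on UNIV q'" "continuous_on UNIV k'"
    unfolding q'_def k'_def by (intro continuous_intros cc cb)+
  hence cr': "continuous_on UNIV r'"
    unfolding r'_def by (intro continuous_intros cq ck) (auto simp: kq)
  have cw: "continuous_on UNIV w"
    unfolding w_def by (intro continuous_intros cq ck) (auto simp: kq)
  have "continuous_on UNIV p3"
    unfolding p3_def
    by (intro continuous_intros cont_p1 continuous_on_compose2[OF cr' cont_\<psi>]
        continuous_on_compose2[OF cw cont_\<psi>]) (auto simp: kq)
  moreover have "p (\<theta> + 2 * pi) = p \<theta>" for \<theta>
    by (simp add: p_def support_fun_def)
  hence P0: "C1_periodic p p1"
    using dp cont_p1 by (simp add: C1_periodic_def)
  moreover have P1: "C1_periodic p1 p2"
    using dp1 cont_p2 C1_periodicD(5)[OF P0] by (simp add: C1_periodic_def)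
  ultimately have P2: "C1_periodic p2 p3"
    using dp2 C1_periodicD(5)[OF P1] by (simp add: C1_periodic_def)
  have "0 < p \<theta> + p2 \<theta>" for \<theta>
    using r(1) by (simp add: p2_def)
  thus ?thesis using that P0 P1 P2 unfolding p_def by blast
qed

section \<open>Functionals of an oval in terms of its support function\<close>

lemma normal_dir_axis: "normal_dir \<theta> = cos \<theta> *\<^sub>R axis 1 1 + sin \<theta> *\<^sub>R axis 2 1"
  by (simp add: vec_eq_iff forall_2 axis_def)

lemma vector2_has_vector_derivative:
  assumes "(f1 has_real_derivative d1) (at t)" "(f2 has_real_derivative d2) (at t)"
  shows "((\<lambda>t. vector [f1 t, f2 t] :: real^2) has_vector_derivative vector [d1, d2]) (at t)"
proof -
  have v: "(vector [x, y] :: real^2) = x *\<^sub>R axis 1 1 + y *\<^sub>R axis 2 1" for x y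
    by (simp add: vec_eq_iff forall_2 axis_def)
  show ?thesis
    unfolding v using assms
    by (auto intro!: derivative_eq_intros simp: has_real_derivative_iff_has_vector_derivative[symmetric])
qed

text \<open>The regularity provided by smooth_support_fun, with \<open>p1, p2, p3\<close> the derivatives of the support function.\<close>
locale smooth_oval =
  fixes K :: "(real^2) set" and p1 p2 p3 :: "real \<Rightarrow> real"
  assumes compact: "compact K" and convex: "convex K" and interior: "interior K \<noteq> {}"
    and C1_p: "C1_periodic (support_fun K) p1" "C1_periodic p1 p2" "C1_periodic p2 p3"
    and radius_pos: "\<And>\<theta>. 0 < support_fun K \<theta> + p2 \<theta>"
begin

abbreviation "p \<equiv> support_fun K"
abbreviation "s1 \<equiv> steiner_point K $ 1"
abbreviation "s2 \<equiv> steiner_point K $ 2"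

text \<open>The splitting of the support function: \<open>a0\<close> is its mean, the Steiner point gives its first harmonic,
and \<open>h\<close> is the remainder, with derivatives \<open>h1, h2, h3\<close>.\<close>
definition "a0 = perimeter K / (2 * pi)"
definition "h \<theta> = p \<theta> - a0 - (s1 * cos \<theta> + s2 * sin \<theta>)"
definition "h1 \<theta> = p1 \<theta> - (s2 * cos \<theta> - s1 * sin \<theta>)"
definition "h2 \<theta> = p2 \<theta> + (s1 * cos \<theta> + s2 * sin \<theta>)"
definition "h3 \<theta> = p3 \<theta> + (s2 * cos \<theta> - s1 * sin \<theta>)"

lemma nonempty: "K \<noteq> {}"
  using interior by auto

lemmas cont_p = C1_periodicD(3)[OF C1_p(1)] C1_periodicD(3)[OF C1_p(2)] C1_periodicD(2,3)[OF C1_p(3)]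

lemma deriv_p: "deriv p = p1" "deriv p1 = p2" "deriv p2 = p3"
  using C1_periodicD(1)[OF C1_p(1)] C1_periodicD(1)[OF C1_p(2)] C1_periodicD(1)[OF C1_p(3)]
  by (auto simp: fun_eq_iff intro: DERIV_imp_deriv)

lemma curv_radius_p: "curv_radius K \<theta> = p \<theta> + p2 \<theta>"
  by (simp add: curv_radius_def curvature_def deriv_p)

lemma perimeter_eq: "perimeter K = circint p"
proof -
  have "perimeter K = circint (\<lambda>\<theta>. p \<theta> + p2 \<theta>)"
    unfolding perimeter_def by (intro integral_cong) (simp add: curv_radius_p)
  also have "\<dots> = circint p + circint p2"
    by (intro circint_add cont_p)
  also have "circint p2 = 0"
    by (rule circint_derivative[OF C1_p(2)])
  finally show ?thesis by simp
qed

lemma perimeter_nonneg: "0 \<le> perimeter K"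
proof -
  have "0 \<le> circint (\<lambda>\<theta>. p \<theta> + p2 \<theta>)"
    using radius_pos by (intro circint_nonneg continuous_intros cont_p) (simp add: less_imp_le)
  moreover have "curv_radius K = (\<lambda>\<theta>. p \<theta> + p2 \<theta>)"
    by (simp add: fun_eq_iff curv_radius_p)
  ultimately show ?thesis
    by (simp add: perimeter_def)
qed

lemma steiner_point_nth:
  "s1 = circint (\<lambda>\<theta>. p \<theta> * cos \<theta>) / pi" "s2 = circint (\<lambda>\<theta>. p \<theta> * sin \<theta>) / pi"
proof -
  have "(\<lambda>\<theta>. p \<theta> *\<^sub>R normal_dir \<theta>) integrable_on {0..2 * pi}"
    unfolding normal_dir_axis by (intro integrable_continuous_real continuous_intros cont_p)
  from integral_component_eq_cart[OF this]
  have "integral {0..2 * pi} (\<lambda>\<theta>. p \<theta> *\<^sub>R normal_dir \<theta>) $ i = circint (\<lambda>\<theta>. p \<theta> * normal_dir \<theta> $ i)" for i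
    by simp
  thus "s1 = circint (\<lambda>\<theta>. p \<theta> * cos \<theta>) / pi" "s2 = circint (\<lambda>\<theta>. p \<theta> * sin \<theta>) / pi"
    by (simp_all add: steiner_point_def)
qed

sublocale higher_harmonics h h1 h2 h3
proof
  have "C1_periodic (\<lambda>\<theta>. s1 * cos \<theta> + s2 * sin \<theta>) (\<lambda>\<theta>. s1 * (- sin \<theta>) + s2 * cos \<theta>)"
    by (intro C1_periodic_intros)
  hence l1: "C1_periodic (\<lambda>\<theta>. s1 * cos \<theta> + s2 * sin \<theta>) (\<lambda>\<theta>. s2 * cos \<theta> - s1 * sin \<theta>)"
    by (simp add: add.commute[of "- _"])
  have "C1_periodic (\<lambda>\<theta>. s2 * cos \<theta> - s1 * sin \<theta>) (\<lambda>\<theta>. s2 * (- sin \<theta>) - s1 * cos \<theta>)"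
    by (intro C1_periodic_intros)
  hence l2: "C1_periodic (\<lambda>\<theta>. s2 * cos \<theta> - s1 * sin \<theta>) (\<lambda>\<theta>. - (s1 * cos \<theta> + s2 * sin \<theta>))"
    by (simp add: minus_diff_commute)
  show "C1_periodic h h1"
    using C1_periodic_diff[OF C1_periodic_diff[OF C1_p(1) C1_periodic_const[of a0]] l1]
    unfolding h_def[abs_def] h1_def[abs_def] by simp
  show "C1_periodic h1 h2"
    using C1_periodic_diff[OF C1_p(2) l2]
    unfolding h1_def[abs_def] h2_def[abs_def] by (simp only: diff_minus_eq_add)
  show "C1_periodic h2 h3"
    using C1_periodic_add[OF C1_p(3) l1]
    unfolding h2_def[abs_def] h3_def[abs_def] .
  show "circint h = 0"
    unfolding h_def[abs_def] using perimeter_eq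
    by (simp add: circint_simps cont_p circint_trig a0_def)
  have "circint (\<lambda>x. h x * cos x)
      = circint (\<lambda>x. p x * cos x - a0 * cos x - (s1 * (cos x * cos x) + s2 * (cos x * sin x)))"
    by (intro integral_cong) (simp add: h_def algebra_simps)
  also have "\<dots> = circint (\<lambda>x. p x * cos x) - s1 * pi"
    by (simp add: circint_simps cont_p circint_trig)
  finally show "circint (\<lambda>x. h x * cos x) = 0"
    by (simp add: steiner_point_nth)
  have "circint (\<lambda>x. h x * sin x)
      = circint (\<lambda>x. p x * sin x - a0 * sin x - (s1 * (cos x * sin x) + s2 * (sin x * sin x)))"
    by (intro integral_cong) (simp add: h_def algebra_simps)
  also have "\<dots> = circint (\<lambda>x. p x * sin x) - s2 * pi"
    by (simp add: circint_simps cont_p circint_trig)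
  finally show "circint (\<lambda>x. h x * sin x) = 0"
    by (simp add: steiner_point_nth)
qed

lemma curv_radius_eq: "curv_radius K \<theta> = h2 \<theta> + h \<theta> + a0"
  by (simp add: curv_radius_p h_def h2_def)

lemma cont_curv_radius: "continuous_on S (curv_radius K)"
  unfolding curv_radius_eq[abs_def] by (intro continuous_intros cont)

lemma support_distance_eq:
  "circint (\<lambda>\<theta>. \<bar>p \<theta> - support_fun (steiner_disk K) \<theta>\<bar>\<^sup>2) = A0"
proof (intro integral_cong)
  fix \<theta>
  have "0 \<le> a0" using perimeter_nonneg by (simp add: a0_def)
  hence "support_fun (steiner_disk K) \<theta> = s1 * cos \<theta> + s2 * sin \<theta> + a0"
    by (simp add: steiner_disk_def support_fun_cball inner_normal_dir flip: a0_def)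
  thus "\<bar>p \<theta> - support_fun (steiner_disk K) \<theta>\<bar>\<^sup>2 = (h \<theta>)\<^sup>2"
    by (simp add: h_def algebra_simps)
qed

lemma circint_h2_h: "circint (\<lambda>x. h2 x + h x) = 0"
  using circint_derivative[OF C1(2)] by (simp add: circint_simps cont mean)

lemma curv_radius_square: "circint (\<lambda>\<theta>. (curv_radius K \<theta>)\<^sup>2) = A2 - 2 * A1 + A0 + 2 * pi * a0\<^sup>2"
proof -
  have "circint (\<lambda>\<theta>. (curv_radius K \<theta>)\<^sup>2)
      = circint (\<lambda>\<theta>. (h2 \<theta> + h \<theta>)\<^sup>2 + 2 * a0 * (h2 \<theta> + h \<theta>) + a0\<^sup>2)"
    by (intro integral_cong) (simp add: curv_radius_eq power2_eq_square algebra_simps)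
  also have "\<dots> = circint (\<lambda>\<theta>. (h2 \<theta> + h \<theta>)\<^sup>2) + 2 * a0 * circint (\<lambda>x. h2 x + h x) + 2 * pi * a0\<^sup>2"
  proof -
    have "circint (\<lambda>\<theta>. 2 * a0 * (h2 \<theta> + h \<theta>)) = 2 * a0 * circint (\<lambda>x. h2 x + h x)"
      by (rule integral_mult_right)
    moreover have "circint (\<lambda>\<theta>. (h2 \<theta> + h \<theta>)\<^sup>2 + 2 * a0 * (h2 \<theta> + h \<theta>) + a0\<^sup>2)
      = circint (\<lambda>\<theta>. (h2 \<theta> + h \<theta>)\<^sup>2) + circint (\<lambda>\<theta>. 2 * a0 * (h2 \<theta> + h \<theta>)) + circint (\<lambda>\<theta>. a0\<^sup>2)"
      by (subst circint_add | intro continuous_intros cont | rule refl)+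
    ultimately show ?thesis by simp
  qed
  finally show ?thesis using second_square[of 1] circint_h2_h by simp
qed

text \<open>The left-hand side is the trinomial \<open>2 (A - R L + \<pi> R\<^sup>2)\<close>, whichever point \<open>x\<close> is taken as origin; on the
right-hand side its square is completed at the mean radius \<open>a0\<close>.\<close>
lemma shifted_isoperimetric_form:
  "circint (\<lambda>\<theta>. (p \<theta> - x \<bullet> normal_dir \<theta> - R)\<^sup>2)
     - circint (\<lambda>\<theta>. (p1 \<theta> - (x $ 2 * cos \<theta> - x $ 1 * sin \<theta>))\<^sup>2) = A0 - A1 + 2 * pi * (a0 - R)\<^sup>2"
proof -
  define u v where "u = s1 - x $ 1" and "v = s2 - x $ 2"
  have 1: "p \<theta> - x \<bullet> normal_dir \<theta> - R = h \<theta> + (a0 - R) + (u * cos \<theta> + v * sin \<theta>)" for \<theta>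
    by (simp add: h_def u_def v_def inner_normal_dir algebra_simps)
  have 2: "p1 \<theta> - (x $ 2 * cos \<theta> - x $ 1 * sin \<theta>) = h1 \<theta> + (v * cos \<theta> - u * sin \<theta>)" for \<theta>
    by (simp add: h1_def u_def v_def algebra_simps)
  show ?thesis
    unfolding 1 2 by (rule isoperimetric_form[OF C1(1) mean])
qed

lemma area_eq: "area K = pi * a0\<^sup>2 + (A0 - A1) / 2"
  using shifted_isoperimetric_form[of 0 0]
  unfolding area_def deriv_p
  by (simp add: circint_simps cont_p)

lemma evolute_area_eq: "evolute_area K = (A1 - A2) / 2"
proof -
  have ev: "evolute K = (\<lambda>\<theta>. vector [- p1 \<theta> * sin \<theta> - p2 \<theta> * cos \<theta>, p1 \<theta> * cos \<theta> - p2 \<theta> * sin \<theta>])"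
    by (auto simp: fun_eq_iff vec_eq_iff forall_2 evolute_def boundary_curve_def curv_radius_p deriv_p
        algebra_simps)
  have der: "vector_derivative (evolute K) (at \<theta>)
      = vector [- (p1 \<theta> + p3 \<theta>) * cos \<theta>, - (p1 \<theta> + p3 \<theta>) * sin \<theta>]" for \<theta>
  proof -
    have "((\<lambda>\<theta>. - p1 \<theta> * sin \<theta> - p2 \<theta> * cos \<theta>) has_real_derivative - (p1 \<theta> + p3 \<theta>) * cos \<theta>) (at \<theta>)"
      by (rule derivative_eq_intros C1_periodicD(1)[OF C1_p(2)] C1_periodicD(1)[OF C1_p(3)] refl)+
        (simp add: algebra_simps)
    moreover have "((\<lambda>\<theta>. p1 \<theta> * cos \<theta> - p2 \<theta> * sin \<theta>) has_real_derivative - (p1 \<theta> + p3 \<theta>) * sin \<theta>) (at \<theta>)"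
      by (rule derivative_eq_intros C1_periodicD(1)[OF C1_p(2)] C1_periodicD(1)[OF C1_p(3)] refl)+
        (simp add: algebra_simps)
    ultimately show ?thesis
      unfolding ev by (intro vector_derivative_at vector2_has_vector_derivative)
  qed
  have "circint (\<lambda>\<theta>. let \<beta> = evolute K \<theta>; \<beta>' = vector_derivative (evolute K) (at \<theta>)
          in \<beta> $ 1 * \<beta>' $ 2 - \<beta> $ 2 * \<beta>' $ 1) = circint (\<lambda>\<theta>. (p1 \<theta>)\<^sup>2 + p3 \<theta> * p1 \<theta>)"
  proof (intro integral_cong)
    fix \<theta>
    have "(- p1 \<theta> * sin \<theta> - p2 \<theta> * cos \<theta>) * (- (p1 \<theta> + p3 \<theta>) * sin \<theta>)
        - (p1 \<theta> * cos \<theta> - p2 \<theta> * sin \<theta>) * (- (p1 \<theta> + p3 \<theta>) * cos \<theta>)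
        = ((p1 \<theta>)\<^sup>2 + p3 \<theta> * p1 \<theta>) * ((sin \<theta>)\<^sup>2 + (cos \<theta>)\<^sup>2)"
      by algebra
    thus "(let \<beta> = evolute K \<theta>; \<beta>' = vector_derivative (evolute K) (at \<theta>)
          in \<beta> $ 1 * \<beta>' $ 2 - \<beta> $ 2 * \<beta>' $ 1) = (p1 \<theta>)\<^sup>2 + p3 \<theta> * p1 \<theta>"
      unfolding der by (simp add: ev)
  qed
  also have "\<dots> = circint (\<lambda>\<theta>. (p1 \<theta>)\<^sup>2) + circint (\<lambda>\<theta>. p3 \<theta> * p1 \<theta>)"
    by (intro circint_add continuous_intros cont_p)
  also have "circint (\<lambda>\<theta>. p3 \<theta> * p1 \<theta>) = - circint (\<lambda>\<theta>. (p2 \<theta>)\<^sup>2)"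
    using circint_by_parts[OF C1_p(3,2)] by (simp add: power2_eq_square)
  also have "circint (\<lambda>\<theta>. (p1 \<theta>)\<^sup>2) + - circint (\<lambda>\<theta>. (p2 \<theta>)\<^sup>2) = A1 - A2"
    using isoperimetric_form[OF C1(2) circint_derivative[OF C1(1)], of 0 s2 "- s1"]
    by (simp add: h1_def h2_def algebra_simps)
  finally show ?thesis by (simp add: evolute_area_def)
qed

lemma evolute_curv_radius_square:
  "circint (\<lambda>\<theta>. (evolute_curv_radius K \<theta>)\<^sup>2) = A3 - 2 * A2 + A1"
proof -
  have "evolute_curv_radius K \<theta> = \<bar>h3 \<theta> + 1 * h1 \<theta>\<bar>" for \<theta>
    by (simp add: evolute_curv_radius_def deriv_p h1_def h3_def algebra_simps)
  thus ?thesis using third_square[of 1] by simp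
qed

text \<open>The translated support function minus \<open>R\<close> vanishes in every closed half circle, so its isoperimetric
form is nonpositive; this is the classical inequality \<open>R L \<ge> A + \<pi> R\<^sup>2\<close>.\<close>
lemma bonnesen_half:
  assumes z: "\<And>a. \<exists>\<theta>\<in>{a..a + pi}. p \<theta> - x \<bullet> normal_dir \<theta> = R"
  shows "2 * pi * (a0 - R)\<^sup>2 \<le> A1 - A0"
proof -
  have "C1_periodic (\<lambda>\<theta>. p \<theta> - (x $ 1 * cos \<theta> + x $ 2 * sin \<theta>) - R)
      (\<lambda>\<theta>. p1 \<theta> - (x $ 1 * (- sin \<theta>) + x $ 2 * cos \<theta>) - 0)"
    by (intro C1_periodic_intros C1_p)
  hence "C1_periodic (\<lambda>\<theta>. p \<theta> - x \<bullet> normal_dir \<theta> - R) (\<lambda>\<theta>. p1 \<theta> - (x $ 2 * cos \<theta> - x $ 1 * sin \<theta>))"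
    by (simp add: inner_normal_dir)
  from wirtinger_zeros[OF this] z shifted_isoperimetric_form[of x R] show ?thesis
    by simp
qed

text \<open>The second bound comes from the disk of radius \<open>a0 + B\<close> about the Steiner point.\<close>
lemma circumradius_bounds:
  "2 * pi * (a0 - circumradius K)\<^sup>2 \<le> A1 - A0"
  "(\<And>\<theta>. h \<theta> \<le> B) \<Longrightarrow> circumradius K \<le> a0 + B"
proof -
  obtain x R where l: "least_offset p x R"
    using least_offset_exists[OF cont_p(1) C1_periodicD(4)[OF C1_p(1)]] by blast
  have R: "circumradius K = R"
    by (rule circumradius_eq_least_offset[OF compact nonempty l])
  show "2 * pi * (a0 - circumradius K)\<^sup>2 \<le> A1 - A0"
    unfolding R using least_offset_contact[OF cont_p(1) C1_periodicD(4)[OF C1_p(1)] l]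
    by (rule bonnesen_half)
  assume B: "\<And>\<theta>. h \<theta> \<le> B"
  have "\<forall>\<theta>. p \<theta> - steiner_point K \<bullet> normal_dir \<theta> \<le> a0 + B"
    using B by (simp add: h_def inner_normal_dir algebra_simps)
  thus "circumradius K \<le> a0 + B"
    unfolding R using l by (auto simp: least_offset_def)
qed

lemma inradius_bounds:
  "2 * pi * (a0 - inradius K)\<^sup>2 \<le> A1 - A0"
  "(\<And>\<theta>. - B \<le> h \<theta>) \<Longrightarrow> a0 - B \<le> inradius K"
proof -
  have c: "continuous_on UNIV (\<lambda>\<theta>. - p \<theta>)" by (intro continuous_intros cont_p)
  have per: "- p (\<theta> + 2 * pi) = - p \<theta>" for \<theta> using C1_periodicD(4)[OF C1_p(1)] by simp
  obtain x R where l: "least_offset (\<lambda>\<theta>. - p \<theta>) x R"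
    using least_offset_exists[OF c per] by blast
  have R: "inradius K = - R"
    by (rule inradius_eq_least_offset[OF compact convex nonempty l])
  have "\<exists>\<theta>\<in>{a..a + pi}. p \<theta> - (- x) \<bullet> normal_dir \<theta> = - R" for a
  proof -
    obtain \<theta> where "\<theta> \<in> {a..a + pi}" "- p \<theta> - x \<bullet> normal_dir \<theta> = R"
      using least_offset_contact[OF c per l] by blast
    thus ?thesis by (intro bexI[of _ \<theta>]) (auto simp: algebra_simps)
  qed
  thus "2 * pi * (a0 - inradius K)\<^sup>2 \<le> A1 - A0"
    unfolding R by (rule bonnesen_half)
  assume B: "\<And>\<theta>. - B \<le> h \<theta>"
  have "- p \<theta> - (- steiner_point K) \<bullet> normal_dir \<theta> \<le> B - a0" for \<theta>
    using B[of \<theta>] by (simp add: h_def inner_normal_dir algebra_simps)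
  hence "R \<le> B - a0"
    using l unfolding least_offset_def by blast
  thus "a0 - B \<le> inradius K" unfolding R by simp
qed

lemma inradius_le_circumradius: "inradius K \<le> circumradius K"
proof -
  have per: "p (\<theta> + 2 * pi) = p \<theta>" "- p (\<theta> + 2 * pi) = - p \<theta>" for \<theta>
    using C1_periodicD(4)[OF C1_p(1)] by simp_all
  have c: "continuous_on UNIV (\<lambda>\<theta>. - p \<theta>)" by (intro continuous_intros cont_p)
  obtain x R where l: "least_offset p x R"
    using least_offset_exists[OF cont_p(1) per(1)] by blast
  obtain y r where l': "least_offset (\<lambda>\<theta>. - p \<theta>) y r"
    using least_offset_exists[OF c per(2)] by blast
  obtain \<theta> where th: "(- y - x) \<bullet> normal_dir \<theta> = norm (- y - x)" by (rule inner_normal_dir_eq_norm)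
  have "p \<theta> - x \<bullet> normal_dir \<theta> \<le> R" "- p \<theta> - y \<bullet> normal_dir \<theta> \<le> r"
    using l l' by (auto simp: least_offset_def)
  moreover have "0 \<le> - (y \<bullet> normal_dir \<theta>) - x \<bullet> normal_dir \<theta>"
    using th norm_ge_zero[of "- y - x"] by (simp add: inner_diff_left del: norm_ge_zero)
  ultimately have "- r \<le> R" by linarith
  thus ?thesis
    using circumradius_eq_least_offset[OF compact nonempty l]
      inradius_eq_least_offset[OF compact convex nonempty l'] by simp
qed

text \<open>Both radii lie within \<open>sqrt ((A1 - A0) / (2 \<pi>))\<close> of the mean radius \<open>a0\<close>. In classical terms
\<open>2 \<pi> (A1 - A0) = L\<^sup>2 - 4 \<pi> A\<close>.\<close>
lemma bonnesen: "pi * (circumradius K - inradius K)\<^sup>2 \<le> 2 * (A1 - A0)"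
proof -
  have "(circumradius K - inradius K)\<^sup>2 \<le> 2 * (a0 - circumradius K)\<^sup>2 + 2 * (a0 - inradius K)\<^sup>2"
  proof -
    have "0 \<le> ((a0 - circumradius K) + (a0 - inradius K))\<^sup>2" by simp
    thus ?thesis by (simp add: power2_eq_square algebra_simps)
  qed
  hence "pi * (circumradius K - inradius K)\<^sup>2 \<le> pi * (2 * (a0 - circumradius K)\<^sup>2 + 2 * (a0 - inradius K)\<^sup>2)"
    by (rule mult_left_mono) simp
  also have "\<dots> \<le> 2 * (A1 - A0)"
    using circumradius_bounds(1) inradius_bounds(1) by (simp add: algebra_simps)
  finally show ?thesis .
qed

lemma curv_radius_range: "curv_radius_min K \<le> curv_radius K \<theta>" "curv_radius K \<theta> \<le> curv_radius_max K"
proof -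
  have "curv_radius K (\<theta> + 2 * pi) = curv_radius K \<theta>" for \<theta>
    using C1_periodicD(4)[OF C1(1)] C1_periodicD(4)[OF C1(3)] by (simp add: curv_radius_eq)
  then obtain y where y: "0 \<le> y" "y \<le> 0 + 2 * pi" "curv_radius K \<theta> = curv_radius K y"
    using periodic_reduce[of "curv_radius K" "2 * pi" 0 \<theta>] by auto
  have "bounded (curv_radius K ` {0..2 * pi})"
    by (intro compact_imp_bounded compact_continuous_image cont_curv_radius) auto
  hence bdd: "bdd_above (curv_radius K ` {0..2 * pi})" "bdd_below (curv_radius K ` {0..2 * pi})"
    by (auto intro: bounded_imp_bdd_above bounded_imp_bdd_below)
  show "curv_radius_min K \<le> curv_radius K \<theta>" "curv_radius K \<theta> \<le> curv_radius_max K"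
    unfolding curv_radius_min_def curv_radius_max_def y(3)
    using y(1,2) by (auto intro!: cINF_lower cSUP_upper bdd)
qed

lemma curv_radius_oscillation:
  "2 * (A2 - 2 * A1 + A0) \<le> pi * (curv_radius_max K - curv_radius_min K)\<^sup>2"
proof -
  have "circint (\<lambda>x. (h2 x + h x)\<^sup>2) \<le> pi / 2 * ((curv_radius_max K - a0) - (curv_radius_min K - a0))\<^sup>2"
    using curv_radius_range unfolding curv_radius_eq
    by (intro popoviciu continuous_intros cont circint_h2_h) (auto simp: algebra_simps)
  thus ?thesis using second_square[of 1] by simp
qed

lemma curvature_energy_nonneg: "0 \<le> curvature_energy K"
proof -
  have pos: "0 < curv_radius K \<theta>" for \<theta> using radius_pos curv_radius_p by simp
  have "(curvature K \<theta>)\<^sup>2 * curv_radius K \<theta> = 1 / curv_radius K \<theta>" for \<theta>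
    using pos[of \<theta>] by (simp add: curv_radius_def power2_eq_square)
  moreover have "continuous_on UNIV (\<lambda>\<theta>. 1 / curv_radius K \<theta>)"
    using pos by (intro continuous_intros cont_curv_radius) (metis less_irrefl)
  ultimately show ?thesis
    unfolding curvature_energy_def using pos by (simp add: circint_nonneg less_imp_le)
qed

lemma a0_pos: "0 < a0"
proof (rule ccontr)
  assume n: "\<not> 0 < a0"
  have pos: "0 < curv_radius K \<theta>" for \<theta> using radius_pos curv_radius_p by simp
  have zero: "circint (curv_radius K) = 0"
    using n perimeter_nonneg by (simp add: a0_def perimeter_def zero_less_divide_iff)
  have per: "curv_radius K (\<theta> + 2 * pi) = curv_radius K \<theta>" for \<theta>
    using C1_periodicD(4)[OF C1(1)] C1_periodicD(4)[OF C1(3)] by (simp add: curv_radius_eq)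
  have "curv_radius K 0 = 0"
    by (rule circint_eq_0D[OF cont_curv_radius per less_imp_le[OF pos] zero])
  thus False using pos[of 0] by simp
qed

lemma A0_eq_0D:
  assumes "A0 = 0"
  shows "h \<theta> = 0"
proof -
  have "continuous_on UNIV (\<lambda>x. (h x)\<^sup>2)" by (intro continuous_intros cont)
  from circint_eq_0D[OF this _ _ assms, of \<theta>] show ?thesis
    by (simp add: C1_periodicD(4)[OF C1(1)])
qed

text \<open>If \<open>h = 0\<close>, then \<open>K\<close> and its Steiner disk have the same support function.\<close>
lemma disk_if_A0_eq_0:
  assumes "A0 = 0"
  shows "is_disk K"
proof -
  have p: "p \<theta> = support_fun (cball (steiner_point K) a0) \<theta>" for \<theta>
    using A0_eq_0D[OF assms, of \<theta>] a0_pos by (simp add: h_def support_fun_cball inner_normal_dir)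
  have ne: "cball (steiner_point K) a0 \<noteq> {}" using a0_pos by simp
  have "x \<in> K \<longleftrightarrow> x \<in> cball (steiner_point K) a0" for x
    by (simp only: in_iff_support_fun[OF compact convex nonempty]
        in_iff_support_fun[OF compact_cball convex_cball ne] p)
  hence "K = cball (steiner_point K) a0" by blast
  thus ?thesis using a0_pos by (auto simp: is_disk_def)
qed

text \<open>The support function of a disk is a constant plus a first harmonic, and \<open>h\<close> is orthogonal to all of
these; so \<open>h\<close>, which is of this form itself, is orthogonal to itself.\<close>
lemma disk_imp_h_eq_0:
  assumes "is_disk K"
  shows "h \<theta> = 0"
proof -
  obtain x r where r: "r > 0" and K: "K = cball x r" using assms by (auto simp: is_disk_def)
  define c u v where "c = r - a0" and "u = x $ 1 - s1" and "v = x $ 2 - s2"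
  have "h \<theta> = c + u * cos \<theta> + v * sin \<theta>" for \<theta>
  proof -
    have "p \<theta> = x \<bullet> normal_dir \<theta> + r" unfolding K using r by (intro support_fun_cball) simp
    thus ?thesis by (simp add: h_def c_def u_def v_def inner_normal_dir algebra_simps)
  qed
  hence "A0 = circint (\<lambda>\<theta>. c * h \<theta> + u * (h \<theta> * cos \<theta>) + v * (h \<theta> * sin \<theta>))"
    by (intro integral_cong) (metis (no_types, lifting) distrib_left mult.assoc mult.commute power2_eq_square)
  also have "\<dots> = 0"
    by (simp add: circint_simps cont mean orth_cos orth_sin)
  finally show ?thesis by (rule A0_eq_0D)
qed

lemma disk_imp_derivatives_eq_0:
  assumes "is_disk K"
  shows "h1 \<theta> = 0" "h2 \<theta> = 0" "h3 \<theta> = 0"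
proof -
  have z: "f' \<theta> = 0" if "C1_periodic f f'" "\<And>\<theta>. f \<theta> = 0" for f f' :: "real \<Rightarrow> real" and \<theta>
  proof -
    have "f = (\<lambda>_. 0)" using that(2) by auto
    thus ?thesis using C1_periodicD(1)[OF that(1), of \<theta>] DERIV_unique[OF _ DERIV_const] by blast
  qed
  have 1: "h1 \<theta> = 0" for \<theta> using z[OF C1(1)] disk_imp_h_eq_0[OF assms] by blast
  have 2: "h2 \<theta> = 0" for \<theta> using z[OF C1(2)] 1 by blast
  show "h1 \<theta> = 0" "h2 \<theta> = 0" "h3 \<theta> = 0"
    using 1 2 z[OF C1(3)] by blast+
qed

lemma disk_imp_terms_vanish:
  assumes "is_disk K"
  shows "A0 = 0" "A1 = 0" "A2 = 0" "A3 = 0" "circumradius K = inradius K"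
    "curv_radius_max K = curv_radius_min K"
proof -
  note [simp] = disk_imp_h_eq_0[OF assms] disk_imp_derivatives_eq_0[OF assms]
  show "A0 = 0" "A1 = 0" "A2 = 0" "A3 = 0" by simp_all
  show "circumradius K = inradius K"
    using circumradius_bounds(2)[of 0] inradius_bounds(2)[of 0] inradius_le_circumradius by simp
  show "curv_radius_max K = curv_radius_min K"
    by (simp add: curv_radius_max_def curv_radius_min_def curv_radius_eq)
qed

end

section \<open>Stability of the Steiner disk\<close>

text \<open>The deficit in the coordinates whose signs are prescribed. The common factor \<open>2 \<pi>\<close> clears all
denominators, so that this is an identity of polynomials in \<open>\<pi>\<close> and the other quantities.\<close>
lemma deficit_decomposition:
  fixes \<alpha> \<delta> \<mu> \<sigma> \<eta> lam \<xi> \<zeta> A0 A1 A2 A3 a0 e m F :: real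
  assumes W: "W = \<alpha> * (A2 - 2 * A1 + A0 + 2 * pi * a0\<^sup>2) + \<delta> * (2 * pi * a0)\<^sup>2
     + \<mu> * (pi * a0\<^sup>2 + (A0 - A1) / 2) + \<sigma> * ((A2 - A1) / 2) + \<eta> * (A3 - 2 * A2 + A1)
     + lam * e\<^sup>2 + \<xi> * m\<^sup>2 + \<zeta> * F"
    and E: "E = 6*pi*\<alpha> - pi*\<mu> + 4*pi*\<sigma> + 24*pi*\<eta> + 4*lam + 4*\<xi> - 12*pi*\<zeta>"
  shows "2 * pi * W - 3 * E * A0 =
      2 * pi\<^sup>2 * a0\<^sup>2 * (2*\<alpha> + 4*pi*\<delta> + \<mu> - 4*\<zeta>)
    + pi * (2*\<alpha> + \<sigma> - 2*\<eta> - 4*\<zeta>) * (A2 - 5 * A1 + 4 * A0)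
    + E * (A1 - 4 * A0)
    + 2 * pi * \<eta> * (A3 - A2 - 16 * A1 + 16 * A0)
    + (- lam) * (4 * (A1 - A0) - 2 * pi * e\<^sup>2)
    + \<xi> * (2 * pi * m\<^sup>2 - 4 * (A1 - A0))
    + 2 * pi * \<zeta> * (4 * pi * a0\<^sup>2 + 2 * (A2 - 2 * A1 + A0) + F)"
  unfolding W E by (simp add: power2_eq_square field_simps)

theorem theorem1p3:
  fixes K :: "(real^2) set"
    and \<alpha> \<delta> \<mu> \<sigma> \<eta> lam \<xi> \<zeta> W E C dist2 :: real
    and cond :: bool
  assumes K: "strictly_convex_domain K" "bounded_by_smooth_pos_curved_curve K"
    and W: "W = \<alpha> * integral {0..2*pi} (\<lambda>\<theta>. (curv_radius K \<theta>)\<^sup>2)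
              + \<delta> * (perimeter K)\<^sup>2
              + \<mu> * area K
              + \<sigma> * \<bar>evolute_area K\<bar>
              + \<eta> * integral {0..2*pi} (\<lambda>\<theta>. (evolute_curv_radius K \<theta>)\<^sup>2)
              + lam * (circumradius K - inradius K)\<^sup>2
              + \<xi> * (curv_radius_max K - curv_radius_min K)\<^sup>2
              + \<zeta> * curvature_energy K"
    and E: "E = 6*pi*\<alpha> - pi*\<mu> + 4*pi*\<sigma> + 24*pi*\<eta> + 4*lam + 4*\<xi> - 12*pi*\<zeta>"
    and C: "C = 2*pi / (3*E)"
    and cond: "cond \<longleftrightarrow> \<eta> \<ge> 0 \<and> \<xi> \<ge> 0 \<and> \<zeta> \<ge> 0 \<and> lam \<le> 0
                 \<and> 2*\<alpha> + 4*pi*\<delta> + \<mu> - 4*\<zeta> \<ge> 0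
                 \<and> 2*\<alpha> + \<sigma> - 2*\<eta> - 4*\<zeta> \<ge> 0
                 \<and> E > 0"
    and dist2: "dist2 = integral {0..2*pi}
                  (\<lambda>\<theta>. \<bar>support_fun K \<theta> - support_fun (steiner_disk K) \<theta>\<bar>\<^sup>2)"
  shows "(cond \<longrightarrow> dist2 \<le> C * W)
       \<and> (is_disk K \<and> 2*\<alpha> + 4*pi*\<delta> + \<mu> = 0 \<and> \<zeta> = 0 \<and> E \<noteq> 0 \<longrightarrow> dist2 = C * W)
       \<and> (cond \<and> lam\<^sup>2 + \<xi>\<^sup>2 + \<zeta>\<^sup>2 > 0 \<and> dist2 = C * W \<longrightarrow> is_disk K)"
proof -
  obtain p1 p2 p3 where p: "C1_periodic (support_fun K) p1" "C1_periodic p1 p2" "C1_periodic p2 p3"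
    "\<And>\<theta>. 0 < support_fun K \<theta> + p2 \<theta>"
    using smooth_support_fun[OF K] by blast
  interpret smooth_oval K p1 p2 p3
    using K(1) p by unfold_locales (auto simp: strictly_convex_domain_def)
  \<comment> \<open>Opaque names keep the integrals from being unfolded in the arithmetic below.\<close>
  define X0 X1 X2 X3 where X_def: "X0 = A0" "X1 = A1" "X2 = A2" "X3 = A3"
  have X0_nonneg: "0 \<le> X0" and X01: "4 * X0 \<le> X1" and X12: "X1 \<le> X2"
    and X2: "0 \<le> X2 - 5 * X1 + 4 * X0" and X3: "0 \<le> X3 - X2 - 16 * X1 + 16 * X0"
    unfolding X_def using A0_nonneg wirtinger A1_le_A2 second_order third_order by blast+
  define e where "e = circumradius K - inradius K"
  define m where "m = curv_radius_max K - curv_radius_min K"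
  define F where "F = curvature_energy K"
  define u where "u = 2*\<alpha> + 4*pi*\<delta> + \<mu> - 4*\<zeta>"
  define v where "v = 2*\<alpha> + \<sigma> - 2*\<eta> - 4*\<zeta>"
  have d: "dist2 = X0" using support_distance_eq dist2 by (simp add: X_def)
  have "perimeter K = 2 * pi * a0" by (simp add: a0_def)
  moreover have "\<bar>evolute_area K\<bar> = (X2 - X1) / 2"
    using X12 by (simp add: evolute_area_eq X_def)
  ultimately have W': "W = \<alpha> * (X2 - 2 * X1 + X0 + 2 * pi * a0\<^sup>2) + \<delta> * (2 * pi * a0)\<^sup>2
     + \<mu> * (pi * a0\<^sup>2 + (X0 - X1) / 2) + \<sigma> * ((X2 - X1) / 2) + \<eta> * (X3 - 2 * X2 + X1)
     + lam * e\<^sup>2 + \<xi> * m\<^sup>2 + \<zeta> * F"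
    unfolding W curv_radius_square evolute_curv_radius_square area_eq e_def m_def F_def X_def by simp
  define T1 where "T1 = 2 * pi\<^sup>2 * a0\<^sup>2 * u"
  define T2 where "T2 = pi * v * (X2 - 5 * X1 + 4 * X0)"
  define T3 where "T3 = E * (X1 - 4 * X0)"
  define T4 where "T4 = 2 * pi * \<eta> * (X3 - X2 - 16 * X1 + 16 * X0)"
  define T5 where "T5 = (- lam) * (4 * (X1 - X0) - 2 * pi * e\<^sup>2)"
  define T6 where "T6 = \<xi> * (2 * pi * m\<^sup>2 - 4 * (X1 - X0))"
  define T7 where "T7 = 2 * pi * \<zeta> * (4 * pi * a0\<^sup>2 + 2 * (X2 - 2 * X1 + X0) + F)"
  have split: "2 * pi * W - 3 * E * dist2 = T1 + T2 + T3 + T4 + T5 + T6 + T7"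
    unfolding d T1_def T2_def T3_def T4_def T5_def T6_def T7_def u_def v_def
    by (rule deficit_decomposition[OF W' E])
  have curv: "3 * (X1 - X0) \<le> X2 - 2 * X1 + X0"
    using X2 by (simp add: algebra_simps)
  have osc: "6 * (X1 - X0) \<le> pi * m\<^sup>2"
    using curv_radius_oscillation curv unfolding m_def X_def by simp
  have gap: "0 \<le> X1 - X0" using X01 X0_nonneg by linarith
  have pos7: "0 < 4 * pi * a0\<^sup>2 + 2 * (X2 - 2 * X1 + X0) + F"
  proof -
    have "0 < 4 * pi * a0\<^sup>2" using a0_pos by simp
    moreover have "0 \<le> 3 * (X1 - X0)" using gap by simp
    hence "0 \<le> 2 * (X2 - 2 * X1 + X0)" using curv by simp
    moreover have "0 \<le> F" using curvature_energy_nonneg by (simp add: F_def)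
    ultimately show ?thesis by linarith
  qed
  have nonneg: "0 \<le> T1" "0 \<le> T2" "0 \<le> T3" "0 \<le> T4" "0 \<le> T5" "0 \<le> T6" "0 \<le> T7" if cond
  proof -
    have c: "\<eta> \<ge> 0" "\<xi> \<ge> 0" "\<zeta> \<ge> 0" "- lam \<ge> 0" "u \<ge> 0" "v \<ge> 0" "E \<ge> 0"
      using that cond unfolding u_def v_def by auto
    show "0 \<le> T1" unfolding T1_def using c by simp
    show "0 \<le> T2" unfolding T2_def using c X2 by (intro mult_nonneg_nonneg) auto
    show "0 \<le> T3" unfolding T3_def using c X01 by (intro mult_nonneg_nonneg) auto
    show "0 \<le> T4" unfolding T4_def using c X3 by (intro mult_nonneg_nonneg) auto
    show "0 \<le> T5" unfolding T5_def using c bonnesen by (intro mult_nonneg_nonneg) (auto simp: e_def X_def)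
    show "0 \<le> T6" unfolding T6_def using c osc gap by (intro mult_nonneg_nonneg) auto
    show "0 \<le> T7" unfolding T7_def using c pos7 by (intro mult_nonneg_nonneg) auto
  qed
  have i: "dist2 \<le> C * W" if cond
  proof -
    have "3 * E * dist2 \<le> 2 * pi * W" using nonneg[OF that] split by linarith
    thus ?thesis using that cond unfolding C by (simp add: field_simps)
  qed
  have ii: "dist2 = C * W" if "is_disk K" "2*\<alpha> + 4*pi*\<delta> + \<mu> = 0" "\<zeta> = 0"
  proof -
    have "e = 0" "m = 0" using disk_imp_terms_vanish[OF that(1)] by (auto simp: e_def m_def)
    hence "2 * pi * W = 0"
      using split that disk_imp_terms_vanish(1-4)[OF that(1)] unfolding d X_def
      by (simp add: T1_def T2_def T3_def T4_def T5_def T6_def T7_def u_def X_def)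
    thus ?thesis using d disk_imp_terms_vanish(1)[OF that(1)] by (simp add: X_def)
  qed
  have iii: "is_disk K" if cond "lam\<^sup>2 + \<xi>\<^sup>2 + \<zeta>\<^sup>2 > 0" "dist2 = C * W"
  proof -
    have Epos: "E > 0" using that(1) cond by blast
    hence "3 * E * dist2 = 2 * pi * W" using that(3) unfolding C by (simp add: field_simps)
    hence T: "T3 = 0" "T5 = 0" "T6 = 0" "T7 = 0"
      using nonneg[OF that(1)] split by linarith+
    have X1eq: "X1 = 4 * X0" using T(1) Epos by (simp add: T3_def)
    have "\<zeta> = 0" using T(4) pos7 by (simp add: T7_def)
    hence "\<xi> \<noteq> 0 \<or> lam \<noteq> 0" using that(2) by auto
    hence "X0 = 0"
    proof
      assume "\<xi> \<noteq> 0"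
      hence "pi * m\<^sup>2 = 2 * (X1 - X0)" using T(3) by (simp add: T6_def)
      hence "6 * (X1 - X0) \<le> 2 * (X1 - X0)" using osc by simp
      thus ?thesis using X1eq X0_nonneg by simp
    next
      assume "lam \<noteq> 0"
      hence eq: "pi * e\<^sup>2 = 6 * X0" using T(2) X1eq by (simp add: T5_def)
      obtain B where B: "0 \<le> B" "\<And>x. \<bar>h x\<bar> \<le> B" "X0 = pi * B\<^sup>2"
        unfolding X_def using wirtinger_eq_amplitude[OF X1eq[unfolded X_def]] by blast
      have "circumradius K \<le> a0 + B" "a0 - B \<le> inradius K"
        using B(2) by (auto intro!: circumradius_bounds(2) inradius_bounds(2) simp: abs_le_iff minus_le_iff)
      hence "0 \<le> e" "e \<le> 2 * B"
        using inradius_le_circumradius by (auto simp: e_def)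
      hence "e\<^sup>2 \<le> (2 * B)\<^sup>2" by (rule power_mono[rotated])
      moreover have "e\<^sup>2 = 6 * B\<^sup>2" using eq B(3) by simp
      ultimately have "B\<^sup>2 \<le> 0" by (simp add: power_mult_distrib)
      hence "B = 0" by simp
      thus ?thesis using B(3) by simp
    qed
    thus ?thesis unfolding X_def by (rule disk_if_A0_eq_0)
  qed
  show ?thesis using i ii iii by blast
qed

end
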